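(* In any braided VOA $(V,Y,T,\Omega,\mathcal S)$ the map $Y$ satisfies the quasi-associativity relation $$Y(z)(1\otimes Y(w))\,\mathcal S^{23}(w)\mathcal S^{13}(z)=Y(w)\,\mathcal S(w)\,(Y(z-w)\otimes 1).$$ This identity is understood as follows: on the left hand side $Y(z)$ is decomposed as $\sum_m Y^{(m)}(z-w)w^m/m!$, and similarly for $\mathcal S(z)$, and then the equality holds in $\mathrm{Hom}(V\otimes V\otimes V,\,V[[w,w^{-1},z-w,(z-w)^{-1}]])$ modulo any given power of $h$ after multiplication by a suitable power of $z$.
   Context: $k$ is a field of characteristic $0$, $h$ a formal parameter, tensor products are $h$-adically completed. For a topologically free $k[[h]]$-module $V$, $V((z))=\{\sum_{n\in\mathbb Z}v_nz^n:\ v_n\to0\ h\text{-adically as }n\to-\infty\}$. Superscripts indicate tensor factors on which an operator acts; $\mathcal S^{21}=\sigma\mathcal S\sigma$ with $\sigma$ the flip. A braided VOA over $k[[h]]$ is: a topologically free $k[[h]]$-module $V$; a linear map $Y:V\otimes V\to V((z))$, $\mathbf v\otimes\mathbf w\mapsto Y(z)(\mathbf v\otimes\mathbf w)=Y(\mathbf v,z)\mathbf w$; a linear operator $T:V\to V$; a vector $\Omega\in V$; a linear map $\mathcal S(z):V\otimes V\to V\otimes V\otimes k((z))$ with $\mathcal S=1+O(h)$, satisfying the shift condition $[T\otimes1,\mathcal S(z)]=-\frac{d\mathcal S}{dz}$, the quantum Yang–Baxter equation $\mathcal S^{12}(z)\mathcal S^{13}(z+w)\mathcal S^{23}(w)=\mathcal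 S^{23}(w)\mathcal S^{13}(z+w)\mathcal S^{12}(z)$ and unitarity $\mathcal S^{21}(z)=\mathcal S^{-1}(-z)$; subject to: (QA1) for any $\mathbf v,\mathbf w\in V$ and any natural $M$ there is $N\ge0$ such that for any $\mathbf u\in V$, $(z_1-z_2)^NY(z_1)(1\otimes Y(z_2))(\mathcal S(z_1-z_2)(\mathbf v\otimes\mathbf w)\otimes\mathbf u)$ coincides with $(z_1-z_2)^NY(z_2)(1\otimes Y(z_1))(\mathbf w\otimes\mathbf v\otimes\mathbf u)$ modulo $h^M$; (QA2) $T\Omega=0$ and $\frac{d}{dz}Y(z)=TY(z)-Y(z)(1\otimes T)$; (QA3) $Y(z)(\Omega\otimes\mathbf v)=\mathbf v$ for all $\mathbf v$; $Y(z)(\mathbf v\otimes\Omega)$ is regular at $z=0$ and its value there is $\mathbf v$. *)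

theory Defs
  imports
    "HOL-Library.Poly_Mapping"
    "HOL-Library.Product_Plus"
    "HOL-Computational_Algebra.Formal_Power_Series"
begin

section \<open>Topologically free modules over \<open>k[[h]]\<close>\<close>

text \<open>
  A topologically free \<open>k[[h]]\<close>-module is a module of the form \<open>V\<^sub>0[[h]]\<close> for a \<open>k\<close>-vector space
  \<open>V\<^sub>0\<close>. We present \<open>V\<^sub>0\<close> by a basis indexed by the type \<open>'b\<close>, that is, as the space of finitely
  supported functions from \<open>'b\<close> to \<open>k\<close>; the variable of the formal power series is \<open>h\<close>. The
  completed tensor product of \<open>V\<^sub>0[[h]]\<close> and \<open>W\<^sub>0[[h]]\<close> is \<open>(V\<^sub>0 \<otimes> W\<^sub>0)[[h]]\<close>, and \<open>V\<^sub>0 \<otimes> W\<^sub>0\<close> has the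
  product of the two index types as index type.
\<close>

type_synonym ('k, 'b) tfree = "('b \<Rightarrow>\<^sub>0 'k) fps"
type_synonym ('k, 'b) tfree2 = "('k, 'b \<times> 'b) tfree"
type_synonym ('k, 'b) tfree3 = "('k, 'b \<times> 'b \<times> 'b) tfree"

definition hscale :: "'k::comm_ring_1 fps \<Rightarrow> ('k, 'b) tfree \<Rightarrow> ('k, 'b) tfree" (infixr "*\<^sub>h" 75)
  where "c *\<^sub>h v = Abs_fps (\<lambda>n. \<Sum>i\<le>n. Poly_Mapping.map (\<lambda>x. fps_nth c i * x) (fps_nth v (n - i)))"

lemma lookup_hscale: "Poly_Mapping.lookup (fps_nth (c *\<^sub>h v) n) b
    = fps_nth (c * Abs_fps (\<lambda>m. Poly_Mapping.lookup (fps_nth v m) b)) n"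
  by (auto simp: hscale_def lookup_sum Poly_Mapping.map.rep_eq fps_mult_nth when_def
      atLeast0AtMost intro!: sum.cong)

lemma module_hscale: "module (hscale :: 'k::comm_ring_1 fps \<Rightarrow> ('k, 'b) tfree \<Rightarrow> _)"
proof -
  define coord where
    "coord b v = Abs_fps (\<lambda>m. Poly_Mapping.lookup (fps_nth v m) b)" for b and v :: "('k, 'b) tfree"
  have ext: "v = w" if "\<And>b. coord b v = coord b w" for v w
    using that by (auto simp: coord_def fps_eq_iff poly_mapping_eq_iff fun_eq_iff)
  have "coord b (v + w) = coord b v + coord b w" "coord b (c *\<^sub>h v) = c * coord b v" for b c v w
    by (simp_all add: coord_def fps_eq_iff lookup_add lookup_hscale)
  then show ?thesis
    by unfold_locales (auto intro!: ext simp: algebra_simps)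
qed

abbreviation hlinear :: "(('k::comm_ring_1, 'b) tfree \<Rightarrow> ('k, 'c) tfree) \<Rightarrow> bool"
  where "hlinear \<equiv> module_hom hscale hscale"

definition hpow :: "nat \<Rightarrow> ('k::comm_ring_1, 'b) tfree set"  \<comment> \<open>the submodule \<open>h\<^sup>M V\<close>\<close>
  where "hpow M = range (hscale (fps_X ^ M))"

text \<open>
  Sum of an \<open>h\<close>-adically summable family, i.e. a family all but finitely many of whose members
  lie in \<open>h\<^sup>M V\<close>, for each \<open>M\<close>. (For other families the value is meaningless.)
\<close>

definition hsum :: "('i \<Rightarrow> 'a::comm_monoid_add fps) \<Rightarrow> 'a fps"
  where "hsum f = Abs_fps (\<lambda>m. Sum_any (\<lambda>i. fps_nth (f i) m))"

definition bvec :: "'b \<Rightarrow> ('k::comm_ring_1, 'b) tfree"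
  where "bvec a = fps_const (Poly_Mapping.single a 1)"

definition lin_ext :: "('a \<Rightarrow> ('k::comm_ring_1, 'b) tfree) \<Rightarrow> ('k, 'a) tfree \<Rightarrow> ('k, 'b) tfree"
  \<comment> \<open>the \<open>k[[h]]\<close>-linear map with prescribed values on the basis vectors\<close>
  where "lin_ext g v =
    hsum (\<lambda>(m, a). (fps_const (Poly_Mapping.lookup (fps_nth v m) a) * fps_X ^ m) *\<^sub>h g a)"

definition vtensor :: "('b \<Rightarrow>\<^sub>0 'k::comm_ring_1) \<Rightarrow> ('c \<Rightarrow>\<^sub>0 'k) \<Rightarrow> ('b \<times> 'c \<Rightarrow>\<^sub>0 'k)"
  where "vtensor x y = (\<Sum>a\<in>Poly_Mapping.keys x. \<Sum>b\<in>Poly_Mapping.keys y.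
    Poly_Mapping.single (a, b) (Poly_Mapping.lookup x a * Poly_Mapping.lookup y b))"

definition tensor :: "('k::comm_ring_1, 'b) tfree \<Rightarrow> ('k, 'c) tfree \<Rightarrow> ('k, 'b \<times> 'c) tfree"
    (infixr "\<otimes>\<^sub>h" 70)
  where "v \<otimes>\<^sub>h w = Abs_fps (\<lambda>n. \<Sum>i\<le>n. vtensor (fps_nth v i) (fps_nth w (n - i)))"

definition tensor_map ::
    "(('k::comm_ring_1, 'a) tfree \<Rightarrow> ('k, 'c) tfree) \<Rightarrow> (('k, 'b) tfree \<Rightarrow> ('k, 'd) tfree)
      \<Rightarrow> ('k, 'a \<times> 'b) tfree \<Rightarrow> ('k, 'c \<times> 'd) tfree"
  where "tensor_map f g = lin_ext (\<lambda>(a, b). f (bvec a) \<otimes>\<^sub>h g (bvec b))"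

definition flip :: "('k::comm_ring_1, 'b) tfree2 \<Rightarrow> ('k, 'b) tfree2"
  where "flip = lin_ext (\<lambda>(a, b). bvec (b, a))"

definition assocl :: "('k::comm_ring_1, 'b) tfree3 \<Rightarrow> ('k, ('b \<times> 'b) \<times> 'b) tfree"
  where "assocl = lin_ext (\<lambda>(a, b, c). bvec ((a, b), c))"

definition assocr :: "('k::comm_ring_1, ('b \<times> 'b) \<times> 'b) tfree \<Rightarrow> ('k, 'b) tfree3"
  where "assocr = lin_ext (\<lambda>((a, b), c). bvec (a, b, c))"


section \<open>Formal series\<close>

text \<open>
  A formal series \<open>\<Sum>\<^sub>i f\<^sub>i z\<^sup>i\<close> is given by its coefficient function. The exponent \<open>i\<close> is an integer
  for series in one variable, and a pair of integers for series in two variables. An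
  operator-valued series \<open>A\<close> is given by its coefficient operators \<open>A i\<close>.
\<close>

definition laurent :: "(int \<Rightarrow> ('k::comm_ring_1, 'b) tfree) set"  \<comment> \<open>\<open>V((z))\<close>\<close>
  where "laurent = {f. \<forall>M. \<exists>N. \<forall>n<N. f n \<in> hpow M}"

text \<open>
  The completed tensor product of \<open>V = V\<^sub>0[[h]]\<close> with \<open>k((z))\<close> is \<open>(V\<^sub>0 \<otimes> k((z)))[[h]]\<close>: modulo every
  power of \<open>h\<close> its elements are finite sums of terms \<open>v \<otimes> f(z)\<close>, so that the coefficients span
  a finite-dimensional space. This makes it smaller than \<open>V((z))\<close>.
\<close>

definition tensor_laurent :: "(int \<Rightarrow> ('k::comm_ring_1, 'b) tfree) set"
  where "tensor_laurent = {f. \<forall>m. \<exists>N. \<exists>B. finite B \<and>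
    (\<forall>n. Poly_Mapping.keys (fps_nth (f n) m) \<subseteq> B) \<and> (\<forall>n<N. fps_nth (f n) m = 0)}"

type_synonym ('i, 'k, 'a, 'b) opseries = "'i \<Rightarrow> ('k, 'a) tfree \<Rightarrow> ('k, 'b) tfree"

definition ser_comp :: "('i::ab_group_add, 'k::comm_ring_1, 'b, 'c) opseries
      \<Rightarrow> ('i, 'k, 'a, 'b) opseries \<Rightarrow> ('i, 'k, 'a, 'c) opseries" (infixr "\<odot>" 70)
  where "(A \<odot> B) i t = hsum (\<lambda>j. A (i - j) (B j t))"

definition ser_one :: "('i::zero, 'k::comm_ring_1, 'a, 'a) opseries"
  where "ser_one i t = (if i = 0 then t else 0)"

definition ser_deriv :: "(int, 'k::comm_ring_1, 'a, 'b) opseries \<Rightarrow> (int, 'k, 'a, 'b) opseries"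
  where "ser_deriv A n t = of_int (n + 1) *\<^sub>h A (n + 1) t"

definition ser_reflect :: "(int, 'k::comm_ring_1, 'a, 'b) opseries \<Rightarrow> (int, 'k, 'a, 'b) opseries"
  \<comment> \<open>\<open>A(-z)\<close>\<close>
  where "ser_reflect A n t = (if even n then A n t else - A n t)"

text \<open>For \<open>A(z)\<close>, the series \<open>A(x)\<close> and \<open>A(y)\<close> as series in the two variables \<open>x, y\<close>:\<close>

definition in_fst :: "(int, 'k::comm_ring_1, 'a, 'b) opseries \<Rightarrow> (int \<times> int, 'k, 'a, 'b) opseries"
  where "in_fst A = (\<lambda>(p, q) t. if q = 0 then A p t else 0)"

definition in_snd :: "(int, 'k::comm_ring_1, 'a, 'b) opseries \<Rightarrow> (int \<times> int, 'k, 'a, 'b) opseries"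
  where "in_snd A = (\<lambda>(p, q) t. if p = 0 then A q t else 0)"

text \<open>For \<open>A(z)\<close>, the Taylor expansion \<open>A(x + s y) = \<Sum>\<^sub>m A\<^sup>(\<^sup>m\<^sup>)(x) (s y)\<^sup>m / m!\<close> in the two variables \<open>x, y\<close>:\<close>

definition taylor :: "'k::field_char_0 \<Rightarrow> (int, 'k, 'a, 'b) opseries \<Rightarrow> (int \<times> int, 'k, 'a, 'b) opseries"
  where "taylor s A = (\<lambda>(p, q) t. if q < 0 then 0
    else fps_const (s ^ nat q / fact (nat q)) *\<^sub>h (ser_deriv ^^ nat q) A p t)"

text \<open>Multiplication of a series in the two variables \<open>x, y\<close> by \<open>x + s y\<close>:\<close>

definition mult_lin :: "'k::comm_ring_1 \<Rightarrow> (int \<times> int \<Rightarrow> ('k, 'b) tfree) \<Rightarrow> int \<times> int \<Rightarrow> ('k, 'b) tfree"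
  where "mult_lin s f = (\<lambda>(p, q). f (p - 1, q) + fps_const s *\<^sub>h f (p, q - 1))"

definition eq_mod_hpow :: "nat \<Rightarrow> ('i \<Rightarrow> ('k::comm_ring_1, 'b) tfree) \<Rightarrow> ('i \<Rightarrow> ('k, 'b) tfree) \<Rightarrow> bool"
  where "eq_mod_hpow M f g \<longleftrightarrow> (\<forall>i. f i - g i \<in> hpow M)"


section \<open>Action on tensor factors\<close>

definition act21 :: "(int, 'k::comm_ring_1, 'b \<times> 'b, 'b \<times> 'b) opseries
    \<Rightarrow> (int, 'k, 'b \<times> 'b, 'b \<times> 'b) opseries"
  where "act21 S n = flip \<circ> S n \<circ> flip"

definition act12 :: "(int, 'k::comm_ring_1, 'b \<times> 'b, 'b \<times> 'b) opseries
    \<Rightarrow> (int, 'k, 'b \<times> 'b \<times> 'b, 'b \<times> 'b \<times> 'b) opseries"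
  where "act12 S n = assocr \<circ> tensor_map (S n) id \<circ> assocl"

definition act23 :: "(int, 'k::comm_ring_1, 'b \<times> 'b, 'b \<times> 'b) opseries
    \<Rightarrow> (int, 'k, 'b \<times> 'b \<times> 'b, 'b \<times> 'b \<times> 'b) opseries"
  where "act23 S n = tensor_map id (S n)"

definition act13 :: "(int, 'k::comm_ring_1, 'b \<times> 'b, 'b \<times> 'b) opseries
    \<Rightarrow> (int, 'k, 'b \<times> 'b \<times> 'b, 'b \<times> 'b \<times> 'b) opseries"
  where "act13 S n = tensor_map id flip \<circ> act12 S n \<circ> tensor_map id flip"

definition one_tensor :: "(int, 'k::comm_ring_1, 'b \<times> 'b, 'b) opseries
    \<Rightarrow> (int, 'k, 'b \<times> 'b \<times> 'b, 'b \<times> 'b) opseries"  \<comment> \<open>\<open>1 \<otimes> Y\<close>\<close>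
  where "one_tensor Y n = tensor_map id (Y n)"

definition tensor_one :: "(int, 'k::comm_ring_1, 'b \<times> 'b, 'b) opseries
    \<Rightarrow> (int, 'k, 'b \<times> 'b \<times> 'b, 'b \<times> 'b) opseries"  \<comment> \<open>\<open>Y \<otimes> 1\<close>\<close>
  where "tensor_one Y n = tensor_map (Y n) id \<circ> assocl"


section \<open>Braided vertex operator algebras\<close>

text \<open>
  A linear map \<open>Y : V \<otimes> V \<rightarrow> V((z))\<close> is given by its coefficients \<open>Y n : V \<otimes> V \<rightarrow> V\<close>, and similarly
  for \<open>S\<close>. The variables \<open>x, y\<close> of the two-variable series are \<open>z, w\<close> in the Yang-Baxter equation
  and \<open>z\<^sub>1, z\<^sub>2\<close> in the locality axiom. The series \<open>S\<^sup>1\<^sup>3(z + w)\<close> and \<open>S(z\<^sub>1 - z\<^sub>2)\<close> are expanded in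
  nonnegative powers of the second variable. These choices are immaterial: modulo \<open>h\<^sup>M\<close> only
  finitely many negative powers of \<open>z + w\<close> and \<open>z\<^sub>1 - z\<^sub>2\<close> occur when the operators are applied to a vector.
\<close>

locale braided_voa =
  fixes Y :: "(int, 'k::field_char_0, 'b \<times> 'b, 'b) opseries"
    and T :: "('k, 'b) tfree \<Rightarrow> ('k, 'b) tfree"
    and \<Omega> :: "('k, 'b) tfree"
    and S :: "(int, 'k, 'b \<times> 'b, 'b \<times> 'b) opseries"
  assumes Y_linear: "\<And>n. hlinear (Y n)"
    and Y_laurent: "\<And>t. (\<lambda>n. Y n t) \<in> laurent"
    and T_linear: "hlinear T"
    and S_linear: "\<And>n. hlinear (S n)"
    and S_laurent: "\<And>t. (\<lambda>n. S n t) \<in> tensor_laurent"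
    and S_one: "\<And>t. eq_mod_hpow 1 (\<lambda>n. S n t) (\<lambda>n. ser_one n t)"
    and S_shift: "\<And>n t. tensor_map T id (S n t) - S n (tensor_map T id t) = - ser_deriv S n t"
    and yang_baxter:
      "in_fst (act12 S) \<odot> taylor 1 (act13 S) \<odot> in_snd (act23 S)
        = in_snd (act23 S) \<odot> taylor 1 (act13 S) \<odot> in_fst (act12 S)"
    and unitarity:  \<comment> \<open>\<open>S\<^sup>2\<^sup>1(z)\<close> is the two-sided inverse of \<open>S(-z)\<close>\<close>
      "act21 S \<odot> ser_reflect S = ser_one" "ser_reflect S \<odot> act21 S = ser_one"
    and locality: "\<And>v w M. \<exists>N. \<forall>u. eq_mod_hpow M
      ((mult_lin (- 1) ^^ N) (\<lambda>i. (in_fst Y \<odot> in_snd (one_tensor Y) \<odot> taylor (- 1) (act12 S)) i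
        (v \<otimes>\<^sub>h w \<otimes>\<^sub>h u)))
      ((mult_lin (- 1) ^^ N) (\<lambda>i. (in_snd Y \<odot> in_fst (one_tensor Y)) i (w \<otimes>\<^sub>h v \<otimes>\<^sub>h u)))"
    and T_vacuum: "T \<Omega> = 0"
    and Y_deriv: "\<And>n t. ser_deriv Y n t = T (Y n t) - Y n (tensor_map id T t)"
    and vacuum_left: "\<And>n v. Y n (\<Omega> \<otimes>\<^sub>h v) = (if n = 0 then v else 0)"
    and vacuum_right_regular: "\<And>n v. n < 0 \<Longrightarrow> Y n (v \<otimes>\<^sub>h \<Omega>) = 0"
    and vacuum_right: "\<And>v. Y 0 (v \<otimes>\<^sub>h \<Omega>) = v"

end

theory Submission
  imports Defs
begin

text \<open>
  Write \<open>e\<^bsup>zT\<^esup>\<close> for the exponential series of \<open>T\<close> and \<open>\<sigma>\<close> for the flip. Quasi-associativity is locality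
  conjugated by the skew symmetry
    \<open>Y(z) S(z) = e\<^bsup>zT\<^esup> Y(-z) \<sigma>\<close>.
  Indeed, put \<open>x = z - w\<close> and \<open>y = w\<close>. Skew symmetry in the second and third factor turns the left-hand
  side into \<open>Y(x + y) (1 \<otimes> e\<^bsup>yT\<^esup> Y(-y)) S\<^sup>1\<^sup>2(x + y) \<sigma>\<^sup>2\<^sup>3\<close>. The axiom on \<open>dY/dz\<close> integrates to
  \<open>Y(x + y) (1 \<otimes> e\<^bsup>yT\<^esup>) = e\<^bsup>yT\<^esup> Y(x)\<close>, where \<open>Y(x + y)\<close> is expanded in nonnegative powers of \<open>y\<close>; so the
  left-hand side is
    \<open>e\<^bsup>yT\<^esup> Y(x) (1 \<otimes> Y(-y)) S\<^sup>1\<^sup>2(x + y) \<sigma>\<^sup>2\<^sup>3\<close>  (\<open>quasi_associativity_left\<close>).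
  In the same way skew symmetry for the outer factors of the right-hand side gives
    \<open>e\<^bsup>yT\<^esup> Y(-y) (1 \<otimes> Y(x)) \<sigma>\<^sup>1\<^sup>2 \<sigma>\<^sup>2\<^sup>3\<close>  (\<open>quasi_associativity_right\<close>).
  After \<open>e\<^bsup>yT\<^esup>\<close> is removed, the two expressions are the two sides of locality at \<open>z\<^sub>1 = x\<close>, \<open>z\<^sub>2 = -y\<close>,
  and the factor \<open>z\<^sub>1 - z\<^sub>2\<close> is \<open>x + y = z\<close>. All Taylor expansions are in nonnegative powers of \<open>y\<close>, so that
  no domain of expansion changes except in the use of locality.

  Skew symmetry itself is locality applied to the vacuum: \<open>Y(z)(v \<otimes> \<Omega>) = e\<^bsup>zT\<^esup> v\<close>, and the coefficient
  of \<open>z\<^sub>2\<^sup>0\<close> on the two sides of locality for \<open>v, w, \<Omega>\<close> is \<open>z\<^sub>1\<^sup>N\<close> times the two sides of skew symmetry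
  (\<open>skew_symmetry_bvec\<close>).

  The remaining work is convergence. Coefficients of a product of series are infinite sums, which
  make sense \<open>h\<close>-adically, and products have to be reassociated. Associativity comes from Fubini's
  theorem for summable families (\<open>ser_app_assoc\<close>). Summability has one source: modulo \<open>h\<^sup>M\<close> the pole
  order of \<open>A(z)v\<close> is bounded for each \<open>v\<close>, hence uniformly for \<open>v\<close> in a family that involves finitely
  many basis vectors (\<open>bounded_below_uniform\<close>). The condition that \<open>S\<close> takes values in
  \<open>V \<otimes> V \<otimes> k((z))\<close>, and not only in \<open>(V \<otimes> V)((z))\<close>, provides such families.
\<close>


section \<open>Coordinates and linear maps\<close>

definition coord :: "'b \<Rightarrow> ('k::comm_ring_1, 'b) tfree \<Rightarrow> 'k fps"
  where "coord b v = Abs_fps (\<lambda>m. Poly_Mapping.lookup (fps_nth v m) b)"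

lemma coord_nth [simp]: "fps_nth (coord b v) m = Poly_Mapping.lookup (fps_nth v m) b"
  by (simp add: coord_def)

lemma coord_eqI: "(\<And>b. coord b v = coord b w) \<Longrightarrow> v = w"
  by (auto simp: coord_def fps_eq_iff poly_mapping_eq_iff fun_eq_iff)

lemma coord_simps [simp]:
  "coord b 0 = 0" "coord b (v + w) = coord b v + coord b w"
  "coord b (- v) = - coord b v" "coord b (v - w) = coord b v - coord b w"
  "coord b (c *\<^sub>h v) = c * coord b v"
  by (simp_all add: fps_eq_iff lookup_add lookup_minus lookup_hscale coord_def)

lemma coord_sum [simp]: "coord b (\<Sum>i\<in>I. f i) = (\<Sum>i\<in>I. coord b (f i))"
  by (induction I rule: infinite_finite_induct) auto

lemma coord_bvec [simp]: "coord b (bvec a) = (if a = b then 1 else 0)"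
  by (simp add: fps_eq_iff bvec_def lookup_single when_def)

lemma lookup_vtensor:
  "Poly_Mapping.lookup (vtensor x y) (a, b) = Poly_Mapping.lookup x a * Poly_Mapping.lookup y b"
proof -
  have "Poly_Mapping.lookup (vtensor x y) (a, b) =
      (\<Sum>a'\<in>Poly_Mapping.keys x. \<Sum>b'\<in>Poly_Mapping.keys y.
        if a' = a \<and> b' = b then Poly_Mapping.lookup x a * Poly_Mapping.lookup y b else 0)"
    unfolding vtensor_def lookup_sum
    by (intro sum.cong refl) (auto simp: lookup_single when_def)
  also have "\<dots> = (\<Sum>a'\<in>Poly_Mapping.keys x. if a' = a then
      (\<Sum>b'\<in>Poly_Mapping.keys y. if b' = b then Poly_Mapping.lookup x a * Poly_Mapping.lookup y b else 0)
      else 0)"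
    by (intro sum.cong refl) auto
  also have "\<dots> = Poly_Mapping.lookup x a * Poly_Mapping.lookup y b"
    by (auto simp: in_keys_iff)
  finally show ?thesis .
qed

lemma coord_tensor [simp]: "coord (a, b) (v \<otimes>\<^sub>h w) = coord a v * coord b w"
  by (simp add: fps_eq_iff tensor_def lookup_sum lookup_vtensor fps_mult_nth atLeast0AtMost)

lemma hlinearI:
  assumes "\<And>v w. f (v + w) = f v + f w" "\<And>c v. f (c *\<^sub>h v) = c *\<^sub>h f v"
  shows "hlinear f"
  using assms by (simp add: module_hom_iff module_hscale)

lemma hlinear_simps:
  assumes "hlinear f"
  shows "f 0 = 0" "f (v + w) = f v + f w" "f (- v) = - f v" "f (v - w) = f v - f w"
    "f (c *\<^sub>h v) = c *\<^sub>h f v" "f (\<Sum>i\<in>I. g i) = (\<Sum>i\<in>I. f (g i))"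
proof -
  interpret module_hom hscale hscale f by (fact assms)
  show "f 0 = 0" "f (v + w) = f v + f w" "f (- v) = - f v" "f (v - w) = f v - f w"
    "f (c *\<^sub>h v) = c *\<^sub>h f v" "f (\<Sum>i\<in>I. g i) = (\<Sum>i\<in>I. f (g i))"
    by (simp_all add: add neg diff scale sum)
qed

lemma hscale_simps:
  fixes v w :: "('k::comm_ring_1, 'b) tfree"
  shows "c *\<^sub>h 0 = (0 :: ('k, 'b) tfree)" "0 *\<^sub>h v = 0" "1 *\<^sub>h v = v" "(- 1) *\<^sub>h v = - v"
    "c *\<^sub>h (v + w) = c *\<^sub>h v + c *\<^sub>h w" "(c + d) *\<^sub>h v = c *\<^sub>h v + d *\<^sub>h v"
    "c *\<^sub>h (- v) = - (c *\<^sub>h v)" "(- c) *\<^sub>h v = - (c *\<^sub>h v)"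
    "c *\<^sub>h d *\<^sub>h v = (c * d) *\<^sub>h v"
  by (rule coord_eqI, simp add: algebra_simps)+

lemma hlinear_compose:
  assumes "hlinear f" "hlinear g"
  shows "hlinear (\<lambda>v. f (g v))"
  by (intro hlinearI) (simp_all add: hlinear_simps[OF assms(1)] hlinear_simps[OF assms(2)])

lemma hlinear_id: "hlinear (\<lambda>v. v)" and hlinear_zero: "hlinear (\<lambda>v. 0)"
  by (auto intro!: hlinearI simp: hscale_simps)

lemma hlinear_uminus:
  assumes "hlinear f"
  shows "hlinear (\<lambda>v. - f v)"
  by (intro hlinearI) (simp_all add: hlinear_simps[OF assms] hscale_simps)

lemma hlinear_add:
  assumes "hlinear f" "hlinear g"
  shows "hlinear (\<lambda>v. f v + g v)"
  by (intro hlinearI)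
    (simp_all add: hlinear_simps[OF assms(1)] hlinear_simps[OF assms(2)] hscale_simps)

lemma hlinear_hscale:
  assumes "hlinear f"
  shows "hlinear (\<lambda>v. c *\<^sub>h f v)"
  by (intro hlinearI) (simp_all add: hlinear_simps[OF assms] hscale_simps mult.commute)

lemma hlinear_funpow:
  fixes f :: "('k::comm_ring_1, 'b) tfree \<Rightarrow> ('k, 'b) tfree"
  assumes "hlinear f"
  shows "hlinear (f ^^ n)"
proof (induction n)
  case 0
  show ?case using hlinear_id by (simp add: id_def)
next
  case (Suc n)
  show ?case using hlinear_compose[OF assms Suc] by (simp add: comp_def)
qed

lemma hlinear_tensor_left: "hlinear (\<lambda>v. v \<otimes>\<^sub>h w)"
  and hlinear_tensor_right: "hlinear (\<lambda>w. v \<otimes>\<^sub>h w)"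
  by (intro hlinearI; rule coord_eqI; clarsimp simp: algebra_simps)+

lemma hpow_iff: "v \<in> hpow M \<longleftrightarrow> (\<forall>m<M. fps_nth v m = 0)"
proof
  assume "v \<in> hpow M"
  then obtain u where v: "v = fps_X ^ M *\<^sub>h u" by (auto simp: hpow_def)
  show "\<forall>m<M. fps_nth v m = 0"
    by (auto simp: v lookup_hscale fps_X_power_mult_nth intro!: poly_mapping_eqI)
next
  assume v: "\<forall>m<M. fps_nth v m = 0"
  have "v = fps_X ^ M *\<^sub>h Abs_fps (\<lambda>n. fps_nth v (n + M))"
    by (intro fps_ext poly_mapping_eqI) (use v in \<open>auto simp: lookup_hscale fps_X_power_mult_nth\<close>)
  then show "v \<in> hpow M" by (auto simp: hpow_def)
qed

lemma hpow_intros: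
  shows "0 \<in> hpow M" "v \<in> hpow M \<Longrightarrow> w \<in> hpow M \<Longrightarrow> v + w \<in> hpow M"
    "v \<in> hpow M \<Longrightarrow> w \<in> hpow M \<Longrightarrow> v - w \<in> hpow M"
    "v \<in> hpow M \<Longrightarrow> - v \<in> hpow M"
    "(\<And>i. i \<in> I \<Longrightarrow> f i \<in> hpow M) \<Longrightarrow> (\<Sum>i\<in>I. f i) \<in> hpow M"
  by (auto simp: hpow_iff fps_sum_nth)

lemma hlinear_hpow: "hlinear f \<Longrightarrow> v \<in> hpow M \<Longrightarrow> f v \<in> hpow M"
  using hlinear_simps(5)[of f] by (auto simp: hpow_def)

lemma hscale_hpow: "v \<in> hpow M \<Longrightarrow> c *\<^sub>h v \<in> hpow M"
  by (rule hlinear_hpow[OF hlinear_hscale[OF hlinear_id]])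

lemma hpow_diff_trans:
  assumes "u - v \<in> hpow M" "v - w \<in> hpow M"
  shows "u - w \<in> hpow M"
  using hpow_intros(2)[OF assms] by simp

lemma hpow_diff_sym: "u - v \<in> hpow M \<Longrightarrow> v - u \<in> hpow M"
  using hpow_intros(4)[of "u - v" M] by simp

lemma eq_if_diff_hpow: "(\<And>M. v - w \<in> hpow M) \<Longrightarrow> v = w"
  by (auto simp: hpow_iff fps_eq_iff)

definition supp_mod :: "nat \<Rightarrow> 'b set \<Rightarrow> ('k::comm_ring_1, 'b) tfree \<Rightarrow> bool"
  where "supp_mod M B v \<longleftrightarrow> (\<forall>m<M. Poly_Mapping.keys (fps_nth v m) \<subseteq> B)"

lemma supp_modD: "supp_mod M B v \<Longrightarrow> m < M \<Longrightarrow> b \<notin> B \<Longrightarrow> Poly_Mapping.lookup (fps_nth v m) b = 0"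
  unfolding supp_mod_def by (meson in_keys_iff subsetD)

lemma supp_modI:
  "(\<And>m b. m < M \<Longrightarrow> b \<notin> B \<Longrightarrow> Poly_Mapping.lookup (fps_nth v m) b = 0) \<Longrightarrow> supp_mod M B v"
  by (auto simp: supp_mod_def in_keys_iff)

lemma ex_supp_mod: "\<exists>B. finite B \<and> supp_mod M B v"
  by (rule exI[of _ "\<Union>m<M. Poly_Mapping.keys (fps_nth v m)"]) (auto simp: supp_mod_def)

lemma supp_mod_mono: "supp_mod M B v \<Longrightarrow> B \<subseteq> B' \<Longrightarrow> supp_mod M B' v"
  by (auto simp: supp_mod_def)

lemma supp_mod_hpow: "v \<in> hpow M \<Longrightarrow> supp_mod M B v"
  by (auto simp: supp_mod_def hpow_iff)

lemma supp_mod_add: "supp_mod M B v \<Longrightarrow> supp_mod M B w \<Longrightarrow> supp_mod M B (v + w)"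
  by (intro supp_modI) (simp add: lookup_add supp_modD)

lemma supp_mod_sum: "(\<And>i. i \<in> I \<Longrightarrow> supp_mod M B (f i)) \<Longrightarrow> supp_mod M B (\<Sum>i\<in>I. f i)"
  by (intro supp_modI) (auto simp: fps_sum_nth lookup_sum intro!: sum.neutral supp_modD[of M B])

lemma supp_mod_hscale: "supp_mod M B v \<Longrightarrow> supp_mod M B (c *\<^sub>h v)"
  by (intro supp_modI)
    (auto simp: lookup_hscale fps_mult_nth supp_modD intro!: sum.neutral)

text \<open>
  Modulo \<open>h\<^sup>M\<close> every vector is a finite combination of basis vectors, and a \<open>k[[h]]\<close>-linear map
  preserves \<open>h\<^sup>M V\<close>. This is the continuity of linear maps, and it is the way in which statements
  about all vectors are reduced to basis vectors below.
\<close>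

lemma basis_expansion_mod:
  assumes "finite B" "supp_mod M B v"
  shows "v - (\<Sum>a\<in>B. coord a v *\<^sub>h bvec a) \<in> hpow M"
proof -
  have *: "coord b (v - (\<Sum>a\<in>B. coord a v *\<^sub>h bvec a)) = (if b \<in> B then 0 else coord b v)" for b
    using assms(1) by (simp add: if_distrib[of "(*) _"] cong: if_cong)
  have "Poly_Mapping.lookup (fps_nth (v - (\<Sum>a\<in>B. coord a v *\<^sub>h bvec a)) m) b = 0" if "m < M" for m b
    unfolding coord_nth[symmetric] * using supp_modD[OF assms(2) that, of b] by simp
  then have "fps_nth (v - (\<Sum>a\<in>B. coord a v *\<^sub>h bvec a)) m = 0" if "m < M" for m
    by (intro poly_mapping_eqI) (simp only: that lookup_zero)
  then show ?thesis by (simp only: hpow_iff) blast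
qed

lemma hlinear_expansion_mod:
  assumes "hlinear f" "finite B" "supp_mod M B v"
  shows "f v - (\<Sum>a\<in>B. coord a v *\<^sub>h f (bvec a)) \<in> hpow M"
  using hlinear_hpow[OF assms(1) basis_expansion_mod[OF assms(2,3)]]
  by (simp add: hlinear_simps[OF assms(1)])

lemma hlinear_eqI:
  assumes "hlinear f" "hlinear g" "\<And>a. f (bvec a) = g (bvec a)"
  shows "f v = g v"
proof (rule eq_if_diff_hpow)
  fix M
  obtain B where B: "finite B" "supp_mod M B v" using ex_supp_mod by blast
  show "f v - g v \<in> hpow M"
    using hpow_intros(3)[OF hlinear_expansion_mod[OF assms(1) B] hlinear_expansion_mod[OF assms(2) B]]
    by (simp add: assms(3))
qed


section \<open>Summable families\<close>

definition hsummable :: "('i \<Rightarrow> ('k::comm_ring_1, 'b) tfree) \<Rightarrow> bool"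
  where "hsummable F \<longleftrightarrow> (\<forall>M. finite {i. F i \<notin> hpow M})"

lemma hsummable_nth: "hsummable F \<Longrightarrow> finite {i. fps_nth (F i) m \<noteq> 0}"
  unfolding hsummable_def by (rule finite_subset[of _ "{i. F i \<notin> hpow (Suc m)}"]) (auto simp: hpow_iff)

lemma hsummable_mono:
  assumes "hsummable F" "\<And>i M. F i \<in> hpow M \<Longrightarrow> G i \<in> hpow M"
  shows "hsummable G"
  unfolding hsummable_def
proof
  fix M
  have "{i. G i \<notin> hpow M} \<subseteq> {i. F i \<notin> hpow M}" using assms(2) by blast
  then show "finite {i. G i \<notin> hpow M}"
    using assms(1) finite_subset by (auto simp: hsummable_def)
qed

lemma hsummable_linear:
  assumes "\<And>i. hlinear (A i)" "hsummable F"
  shows "hsummable (\<lambda>i. A i (F i))"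
proof (rule hsummable_mono[OF assms(2)])
  show "A i (F i) \<in> hpow M" if "F i \<in> hpow M" for i M
    by (rule hlinear_hpow[OF assms(1) that])
qed

lemma hsummable_add:
  assumes "hsummable F" "hsummable G"
  shows "hsummable (\<lambda>i. F i + G i)"
  unfolding hsummable_def
proof
  fix M
  have "{i. F i + G i \<notin> hpow M} \<subseteq> {i. F i \<notin> hpow M} \<union> {i. G i \<notin> hpow M}"
    using hpow_intros(2) by blast
  then show "finite {i. F i + G i \<notin> hpow M}"
    by (rule finite_subset) (use assms in \<open>auto simp: hsummable_def\<close>)
qed

lemma hsummable_compose_inj:
  assumes "inj r" "hsummable F"
  shows "hsummable (\<lambda>i. F (r i))"
  unfolding hsummable_def
proof
  fix M
  have "finite (r -` {i. F i \<notin> hpow M})"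
    using assms by (intro finite_vimageI) (auto simp: hsummable_def)
  then show "finite {i. F (r i) \<notin> hpow M}" by (simp add: vimage_def)
qed

lemma hsummable_extend_inj:
  assumes "hsummable (\<lambda>i. F (r i))" "\<And>j. j \<notin> range r \<Longrightarrow> F j = 0"
  shows "hsummable F"
  unfolding hsummable_def
proof
  fix M
  have "{j. F j \<notin> hpow M} \<subseteq> r ` {i. F (r i) \<notin> hpow M}"
  proof
    fix j assume "j \<in> {j. F j \<notin> hpow M}"
    then have "F j \<notin> hpow M" by simp
    moreover from this have "j \<in> range r" using assms(2)[of j] hpow_intros(1)[of M] by fastforce
    ultimately show "j \<in> r ` {i. F (r i) \<notin> hpow M}" by auto
  qed
  then show "finite {j. F j \<notin> hpow M}"
    by (rule finite_surj[rotated]) (use assms(1) in \<open>simp add: hsummable_def\<close>)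
qed

lemma hsum_nth: "fps_nth (hsum F) m = Sum_any (\<lambda>i. fps_nth (F i) m)"
  by (simp add: hsum_def)

lemma hsum_eq_sum_mod:
  assumes "finite I" "\<And>i. i \<notin> I \<Longrightarrow> F i \<in> hpow M"
  shows "hsum F - (\<Sum>i\<in>I. F i) \<in> hpow M"
proof -
  have "Sum_any (\<lambda>i. fps_nth (F i) m) = (\<Sum>i\<in>I. fps_nth (F i) m)" if "m < M" for m
    using assms that by (intro Sum_any.expand_superset) (auto simp: hpow_iff)
  then show ?thesis by (simp add: hpow_iff hsum_nth fps_sum_nth)
qed

lemma hsum_eq_sum: "finite I \<Longrightarrow> (\<And>i. i \<notin> I \<Longrightarrow> F i = 0) \<Longrightarrow> hsum F = (\<Sum>i\<in>I. F i)"
  by (simp add: fps_eq_iff hsum_nth fps_sum_nth)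
    (metis (mono_tags, lifting) Sum_any.expand_superset fps_zero_nth mem_Collect_eq subsetI)

lemma hsum_single: "(\<And>i. i \<noteq> j \<Longrightarrow> F i = 0) \<Longrightarrow> hsum F = F j"
  using hsum_eq_sum[of "{j}" F] by simp

lemma hsum_zero: "hsum (\<lambda>i. 0) = 0"
  by (rule trans[OF hsum_eq_sum[of "{}"]]) auto

lemma hsum_uminus: "hsum (\<lambda>i. - F i) = - hsum F" for F :: "'i \<Rightarrow> ('k::comm_ring_1, 'b) tfree"
  by (simp add: fps_eq_iff hsum_nth Sum_any.expand_set sum_negf)

lemma hsum_hpow: "(\<And>i. F i \<in> hpow M) \<Longrightarrow> hsum F \<in> hpow M"
  using hsum_eq_sum_mod[of "{}" F M] by simp

lemma hsum_cong_mod: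
  assumes "\<And>i. F i - G i \<in> hpow M"
  shows "hsum F - hsum G \<in> hpow M"
proof -
  have "fps_nth (F i) m = fps_nth (G i) m" if "m < M" for i m
    using assms[of i] that by (simp add: hpow_iff)
  then show ?thesis by (simp add: hpow_iff hsum_nth)
qed

lemma hsum_add: "hsummable F \<Longrightarrow> hsummable G \<Longrightarrow> hsum (\<lambda>i. F i + G i) = hsum F + hsum G"
  by (simp add: fps_eq_iff hsum_nth Sum_any.distrib hsummable_nth)

text \<open>
  Modulo \<open>h\<^sup>M\<close> the sum is a finite one, and a linear map respects congruence modulo \<open>h\<^sup>M\<close>.
\<close>

lemma hlinear_hsum:
  assumes A: "hlinear A" and F: "hsummable F"
  shows "A (hsum F) = hsum (\<lambda>i. A (F i))"
proof (rule eq_if_diff_hpow)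
  fix M
  define I where "I = {i. F i \<notin> hpow M}"
  have I: "finite I" "\<And>i. i \<notin> I \<Longrightarrow> F i \<in> hpow M"
    using F by (auto simp: I_def hsummable_def)
  have "A (hsum F) - (\<Sum>i\<in>I. A (F i)) \<in> hpow M"
    using hlinear_hpow[OF A hsum_eq_sum_mod[OF I]] by (simp add: hlinear_simps[OF A])
  moreover have "hsum (\<lambda>i. A (F i)) - (\<Sum>i\<in>I. A (F i)) \<in> hpow M"
    by (intro hsum_eq_sum_mod I hlinear_hpow[OF A])
  ultimately show "A (hsum F) - hsum (\<lambda>i. A (F i)) \<in> hpow M"
    using hpow_diff_trans hpow_diff_sym by blast
qed

lemma hsum_reindex: "bij r \<Longrightarrow> hsum (\<lambda>i. F (r i)) = hsum F"
  by (auto simp: fps_eq_iff hsum_nth intro!: Sum_any.reindex_cong[symmetric])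

lemma hsum_inj:
  assumes "inj r" "\<And>j. j \<notin> range r \<Longrightarrow> F j = 0"
  shows "hsum F = hsum (\<lambda>i. F (r i))"
proof (rule fps_ext)
  fix m
  let ?S = "{i. fps_nth (F (r i)) m \<noteq> 0}"
  have "{j. fps_nth (F j) m \<noteq> 0} = r ` ?S"
  proof
    show "{j. fps_nth (F j) m \<noteq> 0} \<subseteq> r ` ?S"
    proof
      fix j assume j: "j \<in> {j. fps_nth (F j) m \<noteq> 0}"
      then have "j \<in> range r" using assms(2)[of j] by fastforce
      with j show "j \<in> r ` ?S" by auto
    qed
  qed auto
  then show "fps_nth (hsum F) m = fps_nth (hsum (\<lambda>i. F (r i))) m"
    using assms(1) by (simp add: hsum_nth Sum_any.expand_set sum.reindex inj_on_subset[OF assms(1)])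
qed

lemma hsum_fubini:
  assumes "hsummable (\<lambda>(i, j). F i j)"
  shows "hsum (\<lambda>i. hsum (F i)) = hsum (\<lambda>(i, j). F i j)"
proof (rule fps_ext)
  fix m
  let ?S = "{(i, j). fps_nth (F i j) m \<noteq> 0}"
  have "finite ?S" using hsummable_nth[OF assms, of m] by (simp add: case_prod_unfold)
  then have "finite (fst ` ?S \<times> snd ` ?S)" by blast
  moreover have "{i. \<exists>j. fps_nth (F i j) m \<noteq> 0} \<times> {j. \<exists>i. fps_nth (F i j) m \<noteq> 0} \<subseteq> fst ` ?S \<times> snd ` ?S"
    by (force simp: image_iff)
  ultimately show "fps_nth (hsum (\<lambda>i. hsum (F i))) m = fps_nth (hsum (\<lambda>(i, j). F i j)) m"
    by (simp add: hsum_nth case_prod_beta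
        Sum_any.cartesian_product[of _ "\<lambda>i j. fps_nth (F i j) m", unfolded case_prod_beta])
qed

lemma hsum_swap:
  fixes F :: "'i \<Rightarrow> 'j \<Rightarrow> ('k::comm_ring_1, 'b) tfree"
  assumes "hsummable (\<lambda>(i, j). F i j)"
  shows "hsum (\<lambda>i. hsum (F i)) = hsum (\<lambda>j. hsum (\<lambda>i. F i j))"
proof -
  have b: "bij (prod.swap :: 'j \<times> 'i \<Rightarrow> 'i \<times> 'j)" by (rule bij_swap)
  have "hsummable (\<lambda>(j, i). F i j)"
    using hsummable_compose_inj[OF bij_is_inj[OF b] assms] by (simp add: case_prod_unfold)
  then have "hsum (\<lambda>j. hsum (\<lambda>i. F i j)) = hsum (\<lambda>(j, i). F i j)" by (rule hsum_fubini)
  also have "\<dots> = hsum (\<lambda>(i, j). F i j)"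
    using hsum_reindex[OF b, of "\<lambda>(i, j). F i j"] by (simp add: case_prod_unfold)
  finally show ?thesis using hsum_fubini[OF assms] by simp
qed


section \<open>Tensor calculus\<close>

text \<open>
  The definition of \<open>lin_ext\<close> sums over pairs of a power of \<open>h\<close> and a basis vector, which hides that
  it is \<open>k[[h]]\<close>-homogeneous. Summing over the powers of \<open>h\<close> first makes this visible.
\<close>

lemma
  fixes g :: "'a \<Rightarrow> ('k::comm_ring_1, 'b) tfree"
  shows lin_ext_eq_hsum: "lin_ext g v = hsum (\<lambda>a. coord a v *\<^sub>h g a)"
    and hsummable_coord: "hsummable (\<lambda>a. coord a v *\<^sub>h g a)"
proof -
  define F where "F = (\<lambda>a m. (fps_const (Poly_Mapping.lookup (fps_nth v m) a) * fps_X ^ m) *\<^sub>h g a)"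
  have coef: "Poly_Mapping.lookup (fps_nth (F a m) k) b =
      (if m \<le> k then Poly_Mapping.lookup (fps_nth v m) a * Poly_Mapping.lookup (fps_nth (g a) (k - m)) b else 0)"
    for a m k b
    by (simp add: F_def lookup_hscale mult.assoc fps_X_power_mult_nth)
  have zero: "F a m \<in> hpow M" if "a \<notin> Poly_Mapping.keys (fps_nth v m) \<or> m \<ge> M" for a m M
    using that by (auto simp: hpow_iff coef in_keys_iff intro!: poly_mapping_eqI)
  have summable: "hsummable (\<lambda>(a, m). F a m)"
    unfolding hsummable_def
  proof
    fix M
    have "{i. (case i of (a, m) \<Rightarrow> F a m) \<notin> hpow M} \<subseteq> (\<Union>m<M. Poly_Mapping.keys (fps_nth v m)) \<times> {..<M}"
    proof
      fix i assume "i \<in> {i. (case i of (a, m) \<Rightarrow> F a m) \<notin> hpow M}"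
      then show "i \<in> (\<Union>m<M. Poly_Mapping.keys (fps_nth v m)) \<times> {..<M}"
        using zero[of "fst i" "snd i" M] by (cases i) force
    qed
    then show "finite {i. (case i of (a, m) \<Rightarrow> F a m) \<notin> hpow M}"
      by (rule finite_subset) auto
  qed
  have inner: "hsum (F a) = coord a v *\<^sub>h g a" for a
  proof (intro fps_ext poly_mapping_eqI)
    fix k b
    have "fps_nth (hsum (F a)) k = (\<Sum>m\<le>k. fps_nth (F a m) k)"
      unfolding hsum_nth
      by (rule Sum_any.expand_superset) (auto, metis (no_types, lifting) coef lookup_zero poly_mapping_eqI)
    then show "Poly_Mapping.lookup (fps_nth (hsum (F a)) k) b =
        Poly_Mapping.lookup (fps_nth (coord a v *\<^sub>h g a) k) b"
      by (simp add: lookup_sum coef lookup_hscale fps_mult_nth atLeast0AtMost)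
  qed
  have "lin_ext g v = hsum (\<lambda>(m, a). F a m)"
    by (simp add: lin_ext_def F_def)
  also have "\<dots> = hsum (\<lambda>(a, m). F a m)"
    using hsum_reindex[OF bij_swap, of "\<lambda>(a, m). F a m"] by (simp add: case_prod_unfold)
  also have "\<dots> = hsum (\<lambda>a. coord a v *\<^sub>h g a)"
    using hsum_fubini[OF summable] by (simp add: inner)
  finally show "lin_ext g v = hsum (\<lambda>a. coord a v *\<^sub>h g a)" .
  show "hsummable (\<lambda>a. coord a v *\<^sub>h g a)"
    unfolding hsummable_def
  proof
    fix M
    have "coord a v *\<^sub>h g a \<in> hpow M" if "a \<notin> (\<Union>m<M. Poly_Mapping.keys (fps_nth v m))" for a
      unfolding inner[symmetric] using that by (intro hsum_hpow zero) force
    then have "{a. coord a v *\<^sub>h g a \<notin> hpow M} \<subseteq> (\<Union>m<M. Poly_Mapping.keys (fps_nth v m))"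
      by blast
    then show "finite {a. coord a v *\<^sub>h g a \<notin> hpow M}" by (rule finite_subset) auto
  qed
qed

lemma hlinear_lin_ext: "hlinear (lin_ext g)"
proof (rule hlinearI)
  show "lin_ext g (v + w) = lin_ext g v + lin_ext g w" for v w
    by (simp add: lin_ext_eq_hsum hscale_simps hsum_add hsummable_coord)
  show "lin_ext g (c *\<^sub>h v) = c *\<^sub>h lin_ext g v" for c v
    using hlinear_hsum[OF hlinear_hscale[OF hlinear_id] hsummable_coord, of c v g]
    by (simp add: lin_ext_eq_hsum hscale_simps)
qed

lemma lin_ext_bvec [simp]: "lin_ext g (bvec a) = g a"
  using hsum_single[of a "\<lambda>b. coord b (bvec a) *\<^sub>h g b"]
  by (simp add: lin_ext_eq_hsum hscale_simps)

lemma tensor_bvec [simp]: "bvec a \<otimes>\<^sub>h bvec b = bvec (a, b)"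
  by (rule coord_eqI) (clarsimp simp: coord_simps)

lemma hlinear_tensor_map: "hlinear (tensor_map f g)"
  unfolding tensor_map_def by (rule hlinear_lin_ext)

lemma tensor_map_bvec [simp]: "tensor_map f g (bvec (a, b)) = f (bvec a) \<otimes>\<^sub>h g (bvec b)"
  by (simp add: tensor_map_def)

lemma hlinear_eqI2:
  assumes "\<And>w. hlinear (\<lambda>v. f v w)" "\<And>v. hlinear (f v)"
    and "\<And>w. hlinear (\<lambda>v. g v w)" "\<And>v. hlinear (g v)"
    and "\<And>a b. f (bvec a) (bvec b) = g (bvec a) (bvec b)"
  shows "f v w = g v w"
proof -
  have "f (bvec a) w = g (bvec a) w" for a
    by (rule hlinear_eqI[OF assms(2,4,5)])
  then show ?thesis by (rule hlinear_eqI[OF assms(1,3)])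
qed

lemma tensor_map_tensor:
  assumes "hlinear f" "hlinear g"
  shows "tensor_map f g (v \<otimes>\<^sub>h w) = f v \<otimes>\<^sub>h g w"
  by (rule hlinear_eqI2[of "\<lambda>v w. tensor_map f g (v \<otimes>\<^sub>h w)"])
    (simp_all add: hlinear_compose[OF hlinear_tensor_map] hlinear_tensor_left hlinear_tensor_right
      hlinear_compose[OF _ assms(1), of "\<lambda>v. v \<otimes>\<^sub>h _"] hlinear_compose[OF _ assms(2)])

lemma hlinear_flip: "hlinear flip" and hlinear_assocl: "hlinear assocl"
  and hlinear_assocr: "hlinear assocr"
  by (simp_all add: flip_def assocl_def assocr_def hlinear_lin_ext)

lemma flip_bvec [simp]: "flip (bvec (a, b)) = bvec (b, a)"
  and assocl_bvec [simp]: "assocl (bvec (a, b, c)) = bvec ((a, b), c)"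
  and assocr_bvec [simp]: "assocr (bvec ((a, b), c)) = bvec (a, b, c)"
  by (simp_all add: flip_def assocl_def assocr_def)

lemma flip_tensor: "flip (v \<otimes>\<^sub>h w) = w \<otimes>\<^sub>h v"
  by (rule hlinear_eqI2[of "\<lambda>v w. flip (v \<otimes>\<^sub>h w)"])
    (simp_all add: hlinear_compose[OF hlinear_flip] hlinear_tensor_left hlinear_tensor_right)

lemma hlinear_id_fun: "hlinear id"
  using hlinear_id by (simp add: id_def)

lemmas hlinear_intros = hlinear_id hlinear_id_fun hlinear_tensor_map hlinear_flip hlinear_assocl
  hlinear_assocr hlinear_tensor_left hlinear_tensor_right


lemma assocl_tensor_bvec: "assocl (bvec a \<otimes>\<^sub>h bvec b \<otimes>\<^sub>h u) = bvec (a, b) \<otimes>\<^sub>h u"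
  by (rule hlinear_eqI[OF hlinear_compose[OF hlinear_assocl hlinear_compose]])
    (simp_all add: hlinear_intros)

lemma assocr_tensor_bvec: "assocr (bvec (a, b) \<otimes>\<^sub>h u) = bvec a \<otimes>\<^sub>h bvec b \<otimes>\<^sub>h u"
  by (rule hlinear_eqI[OF hlinear_compose[OF hlinear_assocr] hlinear_compose])
    (simp_all add: hlinear_intros)

definition swap12 :: "('k::comm_ring_1, 'b) tfree3 \<Rightarrow> ('k, 'b) tfree3"
  where "swap12 = lin_ext (\<lambda>(a, b, c). bvec (b, a, c))"

lemma hlinear_swap12: "hlinear swap12" and swap12_bvec [simp]: "swap12 (bvec (a, b, c)) = bvec (b, a, c)"
  by (simp_all add: swap12_def hlinear_lin_ext)


section \<open>Lower bounds and finite-dimensional ranges\<close>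

text \<open>
  The map \<open>\<rho>\<close> extracts the exponent in question from the index. With \<open>\<rho>\<close> the identity this is
  membership in \<open>V((z))\<close>; with a projection it expresses bounds that are uniform in another index.
\<close>

definition bounded_below :: "('i \<Rightarrow> int) \<Rightarrow> ('i \<Rightarrow> ('k::comm_ring_1, 'b) tfree) \<Rightarrow> bool"
  where "bounded_below \<rho> F \<longleftrightarrow> (\<forall>M. \<exists>N. \<forall>i. \<rho> i < N \<longrightarrow> F i \<in> hpow M)"

definition fin_dim :: "('i \<Rightarrow> ('k::comm_ring_1, 'b) tfree) \<Rightarrow> bool"
  where "fin_dim F \<longleftrightarrow> (\<forall>M. \<exists>B. finite B \<and> (\<forall>i. supp_mod M B (F i)))"

lemma bounded_below_linear:
  assumes "\<And>i. hlinear (C i)" "bounded_below \<rho> F"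
  shows "bounded_below \<rho> (\<lambda>i. C i (F i))"
  using assms(2) unfolding bounded_below_def by (meson hlinear_hpow[OF assms(1)])

lemma bounded_below_compose:
  assumes "bounded_below \<rho> F" "\<And>j. \<rho> (r j) \<le> \<tau> j"
  shows "bounded_below \<tau> (\<lambda>j. F (r j))"
  using assms unfolding bounded_below_def by (meson le_less_trans)

lemma fin_dim_compose: "fin_dim F \<Longrightarrow> fin_dim (\<lambda>j. F (r j))"
  unfolding fin_dim_def by meson

lemma fin_dim_const: "fin_dim (\<lambda>i. v)"
  unfolding fin_dim_def using ex_supp_mod by blast

lemma fin_dim_sum:
  assumes "finite I" "\<And>i. i \<in> I \<Longrightarrow> fin_dim (F i)"
  shows "fin_dim (\<lambda>j. \<Sum>i\<in>I. F i j)"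
  unfolding fin_dim_def
proof
  fix M
  have "\<forall>i\<in>I. \<exists>B. finite B \<and> (\<forall>j. supp_mod M B (F i j))"
    using assms(2) by (auto simp: fin_dim_def)
  then obtain B where B: "\<And>i. i \<in> I \<Longrightarrow> finite (B i)" "\<And>i j. i \<in> I \<Longrightarrow> supp_mod M (B i) (F i j)"
    using bchoice[of I "\<lambda>i B. finite B \<and> (\<forall>j. supp_mod M B (F i j))"] by blast
  show "\<exists>B. finite B \<and> (\<forall>j. supp_mod M B (\<Sum>i\<in>I. F i j))"
    using assms(1) B(1)
    by (intro exI[of _ "\<Union>i\<in>I. B i"] conjI allI supp_mod_sum) (auto intro: supp_mod_mono[OF B(2)])
qed

text \<open>
  The order of the pole of \<open>A(z)v\<close> modulo \<open>h\<^sup>M\<close> depends on \<open>v\<close>. The bound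
  becomes uniform in \<open>v\<close> if \<open>v\<close> ranges over a family which modulo \<open>h\<^sup>M\<close> involves finitely many basis
  vectors, because it is then the minimum of finitely many bounds. The lemma \<open>fin_dim_uniform\<close> is the
  same argument for the set of basis vectors that occur in the values.
\<close>

lemma bounded_below_uniform:
  assumes lin: "\<And>i. hlinear (C i)" and bb: "\<And>a. bounded_below \<rho> (\<lambda>i. C i (bvec a))" and "fin_dim F"
  shows "bounded_below (\<lambda>(i, j). \<rho> i) (\<lambda>(i, j). C i (F j))"
  unfolding bounded_below_def
proof
  fix M
  obtain B where B: "finite B" "\<And>j. supp_mod M B (F j)"
    using assms(3) unfolding fin_dim_def by metis
  have "\<forall>a. \<exists>N. \<forall>i. \<rho> i < N \<longrightarrow> C i (bvec a) \<in> hpow M"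
    using bb by (auto simp: bounded_below_def)
  from choice[OF this] obtain N where N: "\<And>a i. \<rho> i < N a \<Longrightarrow> C i (bvec a) \<in> hpow M"
    by blast
  define N0 where "N0 = Min (insert 0 (N ` B))"
  have "C i (F j) \<in> hpow M" if "\<rho> i < N0" for i j
  proof -
    have "\<rho> i < N a" if "a \<in> B" for a
      using \<open>\<rho> i < N0\<close> Min_le[of "insert 0 (N ` B)" "N a"] B(1) that unfolding N0_def by fastforce
    then have "(\<Sum>a\<in>B. coord a (F j) *\<^sub>h C i (bvec a)) \<in> hpow M"
      by (intro hpow_intros(5) hscale_hpow N)
    then show ?thesis
      using hpow_intros(2)[OF hlinear_expansion_mod[OF lin B(1) B(2)[of j], of i]] by fastforce
  qed
  then show "\<exists>N. \<forall>i. (case i of (i, j) \<Rightarrow> \<rho> i) < N \<longrightarrow> (case i of (i, j) \<Rightarrow> C i (F j)) \<in> hpow M"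
    by (intro exI[of _ N0]) auto
qed

lemma fin_dim_uniform:
  assumes lin: "\<And>i. hlinear (C i)" and fd: "\<And>a. fin_dim (\<lambda>i. C i (bvec a))" and "fin_dim F"
  shows "fin_dim (\<lambda>(i, j). C i (F j))"
  unfolding fin_dim_def
proof
  fix M
  obtain B where B: "finite B" "\<And>j. supp_mod M B (F j)"
    using assms(3) unfolding fin_dim_def by metis
  have "\<forall>a. \<exists>D. finite D \<and> (\<forall>i. supp_mod M D (C i (bvec a)))"
    using fd by (auto simp: fin_dim_def)
  from choice[OF this] obtain D
    where D: "\<And>a. finite (D a)" "\<And>a i. supp_mod M (D a) (C i (bvec a))"
    by blast
  let ?D = "\<Union>a\<in>B. D a"
  have "supp_mod M ?D (C i (F j))" for i j
  proof -
    let ?s = "\<Sum>a\<in>B. coord a (F j) *\<^sub>h C i (bvec a)"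
    have "supp_mod M ?D ?s"
      by (intro supp_mod_sum supp_mod_hscale supp_mod_mono[OF D(2)]) auto
    then have "supp_mod M ?D (C i (F j) - ?s + ?s)"
      by (intro supp_mod_add supp_mod_hpow[OF hlinear_expansion_mod] lin B)
    then show ?thesis by simp
  qed
  then show "\<exists>B. finite B \<and> (\<forall>i. supp_mod M B (case i of (i, j) \<Rightarrow> C i (F j)))"
    using B(1) D(1) by (intro exI[of _ ?D]) auto
qed

lemma fin_dim_linear:
  assumes "hlinear L" "fin_dim F"
  shows "fin_dim (\<lambda>i. L (F i))"
  using fin_dim_compose[OF fin_dim_uniform[of "\<lambda>_. L", OF assms(1) fin_dim_const assms(2)], of "\<lambda>i. ((), i)"]
  by simp

text \<open>
  Linear maps into \<open>W((z))\<close>, and linear maps into \<open>W \<otimes> k((z))\<close>.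
\<close>

definition laurent_op :: "(int, 'k::comm_ring_1, 'a, 'b) opseries \<Rightarrow> bool"
  where "laurent_op A \<longleftrightarrow> (\<forall>n. hlinear (A n)) \<and> (\<forall>t. bounded_below (\<lambda>n. n) (\<lambda>n. A n t))"

definition tensor_laurent_op :: "(int, 'k::comm_ring_1, 'a, 'b) opseries \<Rightarrow> bool"
  where "tensor_laurent_op A \<longleftrightarrow> laurent_op A \<and> (\<forall>t. fin_dim (\<lambda>n. A n t))"

lemma laurent_opI:
  assumes "\<And>n. hlinear (A n)" "\<And>a. bounded_below (\<lambda>n. n) (\<lambda>n. A n (bvec a))"
  shows "laurent_op A"
proof -
  have "bounded_below (\<lambda>n. n) (\<lambda>n. A n t)" for t
    using bounded_below_compose[OF bounded_below_uniform[OF assms fin_dim_const[of t]], of "\<lambda>n. (n, ())" "\<lambda>n. n"]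
    by simp
  with assms(1) show ?thesis by (simp add: laurent_op_def)
qed

lemma tensor_laurent_opI:
  assumes "laurent_op A" "\<And>a. fin_dim (\<lambda>n. A n (bvec a))"
  shows "tensor_laurent_op A"
proof -
  have "fin_dim (\<lambda>n. A n t)" for t
    using fin_dim_compose[OF fin_dim_uniform[of A, OF _ assms(2) fin_dim_const[of t]], of "\<lambda>n. (n, ())"] assms(1)
    by (simp add: laurent_op_def)
  with assms(1) show ?thesis by (simp add: tensor_laurent_op_def)
qed

lemma laurent_op_compose:
  assumes "laurent_op A" "hlinear L" "hlinear R"
  shows "laurent_op (\<lambda>n t. L (A n (R t)))"
proof -
  have "hlinear (A n)" "bounded_below (\<lambda>n. n) (\<lambda>n. A n t)" for n t
    using assms(1) by (auto simp: laurent_op_def)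
  then show ?thesis
    using hlinear_compose[OF assms(2) hlinear_compose[OF _ assms(3)]]
      bounded_below_linear[OF assms(2), of "\<lambda>n. n"]
    by (simp add: laurent_op_def)
qed

lemma tensor_laurent_op_compose:
  assumes "tensor_laurent_op A" "hlinear L" "hlinear R"
  shows "tensor_laurent_op (\<lambda>n t. L (A n (R t)))"
  using assms(1) laurent_op_compose[OF _ assms(2,3)]
  by (simp add: tensor_laurent_op_def fin_dim_linear[OF assms(2)])

lemma laurent_op_tensor_map_left:
  fixes A :: "(int, 'k::comm_ring_1, 'a, 'b) opseries"
  assumes "laurent_op A"
  shows "laurent_op (\<lambda>n. tensor_map (A n) (id :: ('k, 'c) tfree \<Rightarrow> _))"
proof (rule laurent_opI[OF hlinear_tensor_map])
  fix a :: "'a \<times> 'c"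
  obtain a1 a2 where a: "a = (a1, a2)" by (cases a)
  have "bounded_below (\<lambda>n. n) (\<lambda>n. A n (bvec a1) \<otimes>\<^sub>h bvec a2)"
    using assms by (intro bounded_below_linear[OF hlinear_tensor_left]) (simp add: laurent_op_def)
  then show "bounded_below (\<lambda>n. n) (\<lambda>n. tensor_map (A n) id (bvec a))" by (simp add: a)
qed

lemma laurent_op_tensor_map_right:
  fixes A :: "(int, 'k::comm_ring_1, 'a, 'b) opseries"
  assumes "laurent_op A"
  shows "laurent_op (\<lambda>n. tensor_map (id :: ('k, 'c) tfree \<Rightarrow> _) (A n))"
proof (rule laurent_opI[OF hlinear_tensor_map])
  fix a :: "'c \<times> 'a"
  obtain a1 a2 where a: "a = (a1, a2)" by (cases a)
  have "bounded_below (\<lambda>n. n) (\<lambda>n. bvec a1 \<otimes>\<^sub>h A n (bvec a2))"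
    using assms by (intro bounded_below_linear[OF hlinear_tensor_right]) (simp add: laurent_op_def)
  then show "bounded_below (\<lambda>n. n) (\<lambda>n. tensor_map id (A n) (bvec a))" by (simp add: a)
qed

lemma tensor_laurent_op_tensor_map_left:
  fixes A :: "(int, 'k::comm_ring_1, 'a, 'b) opseries"
  assumes "tensor_laurent_op A"
  shows "tensor_laurent_op (\<lambda>n. tensor_map (A n) (id :: ('k, 'c) tfree \<Rightarrow> _))"
proof (rule tensor_laurent_opI[OF laurent_op_tensor_map_left])
  show "laurent_op A" using assms by (simp add: tensor_laurent_op_def)
  fix a :: "'a \<times> 'c"
  obtain a1 a2 where a: "a = (a1, a2)" by (cases a)
  have "fin_dim (\<lambda>n. A n (bvec a1) \<otimes>\<^sub>h bvec a2)"
    using assms by (intro fin_dim_linear[OF hlinear_tensor_left]) (simp add: tensor_laurent_op_def)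
  then show "fin_dim (\<lambda>n. tensor_map (A n) id (bvec a))" by (simp add: a)
qed

lemma tensor_laurent_op_tensor_map_right:
  fixes A :: "(int, 'k::comm_ring_1, 'a, 'b) opseries"
  assumes "tensor_laurent_op A"
  shows "tensor_laurent_op (\<lambda>n. tensor_map (id :: ('k, 'c) tfree \<Rightarrow> _) (A n))"
proof (rule tensor_laurent_opI[OF laurent_op_tensor_map_right])
  show "laurent_op A" using assms by (simp add: tensor_laurent_op_def)
  fix a :: "'c \<times> 'a"
  obtain a1 a2 where a: "a = (a1, a2)" by (cases a)
  have "fin_dim (\<lambda>n. bvec a1 \<otimes>\<^sub>h A n (bvec a2))"
    using assms by (intro fin_dim_linear[OF hlinear_tensor_right]) (simp add: tensor_laurent_op_def)
  then show "fin_dim (\<lambda>n. tensor_map id (A n) (bvec a))" by (simp add: a)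
qed

lemma laurent_op_reflect:
  assumes "laurent_op A"
  shows "laurent_op (ser_reflect A)"
proof -
  have A: "hlinear (A n)" "bounded_below (\<lambda>n. n) (\<lambda>n. A n t)" for n t
    using assms by (auto simp: laurent_op_def)
  have "hlinear (ser_reflect A n)" for n
    using A(1) hlinear_uminus[OF A(1)] by (cases "even n") (simp_all add: ser_reflect_def[abs_def])
  moreover have "bounded_below (\<lambda>n. n) (\<lambda>n. ser_reflect A n t)" for t
    using A(2)[of t] hpow_intros(4) by (simp add: ser_reflect_def bounded_below_def) blast
  ultimately show ?thesis by (simp add: laurent_op_def)
qed


section \<open>Applying operator series to vector series\<close>

text \<open>
  By the definition of \<open>\<odot>\<close>, a right-nested product of operator series applied to a vector is a
  right-nested application. Hence everything can be said about vector series, and associativity is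
  needed only for the series that occur.
\<close>

definition ser_app :: "('i::ab_group_add, 'k::comm_ring_1, 'a, 'b) opseries
    \<Rightarrow> ('i \<Rightarrow> ('k, 'a) tfree) \<Rightarrow> 'i \<Rightarrow> ('k, 'b) tfree" (infixr "\<star>" 70)
  where "(A \<star> f) i = hsum (\<lambda>j. A (i - j) (f j))"

lemma ser_comp_eq_app: "(\<lambda>i. (A \<odot> B) i t) = A \<star> (\<lambda>j. B j t)"
  by (simp add: fun_eq_iff ser_comp_def ser_app_def)

definition applicable :: "('i::ab_group_add, 'k::comm_ring_1, 'a, 'b) opseries
    \<Rightarrow> ('i \<Rightarrow> ('k, 'a) tfree) \<Rightarrow> bool"
  where "applicable A f \<longleftrightarrow> (\<forall>i. hsummable (\<lambda>j. A (i - j) (f j)))"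

lemma bij_shift: "bij (\<lambda>j. j - d)" for d :: "'i::ab_group_add"
  by (rule bij_betw_byWitness[where f' = "\<lambda>j. j + d"]) auto

text \<open>
  Both sides sum \<open>A\<^sub>r (B\<^sub>l f\<^sub>j)\<close> over \<open>r + l + j = i\<close>, in different orders.
\<close>

lemma ser_app_assoc:
  fixes A :: "('i::ab_group_add, 'k::comm_ring_1, 'b, 'c) opseries" and B :: "('i, 'k, 'a, 'b) opseries"
  assumes A: "\<And>n. hlinear (A n)" and "applicable B f"
    and summable: "\<And>i. hsummable (\<lambda>(j, l). A (i - j - l) (B l (f j)))"
  shows "A \<star> (B \<star> f) = (A \<odot> B) \<star> f"
proof
  fix i
  have "inj (\<lambda>(j, m). (j, m - j) :: 'i \<times> 'i)"
    by (rule injI) auto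
  from hsummable_compose_inj[OF this summable[of i]]
  have s: "hsummable (\<lambda>(j, m). A (i - m) (B (m - j) (f j)))"
    by (simp add: case_prod_unfold)
  have "((A \<odot> B) \<star> f) i = hsum (\<lambda>j. hsum (\<lambda>l. A (i - j - l) (B l (f j))))"
    by (simp add: ser_app_def ser_comp_def)
  also have "\<dots> = hsum (\<lambda>j. hsum (\<lambda>m. A (i - m) (B (m - j) (f j))))"
  proof -
    have "hsum (\<lambda>l. A (i - j - l) (B l (f j))) = hsum (\<lambda>m. A (i - m) (B (m - j) (f j)))" for j
      using hsum_reindex[OF bij_shift[of j], of "\<lambda>l. A (i - j - l) (B l (f j))"] by simp
    then show ?thesis by simp
  qed
  also have "\<dots> = hsum (\<lambda>m. hsum (\<lambda>j. A (i - m) (B (m - j) (f j))))"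
    by (rule hsum_swap[OF s])
  also have "\<dots> = (A \<star> (B \<star> f)) i"
    using assms(2) by (simp add: ser_app_def applicable_def hlinear_hsum[OF A])
  finally show "(A \<star> (B \<star> f)) i = ((A \<odot> B) \<star> f) i" ..
qed

lemma ser_app_cong_mod:
  assumes "\<And>n. hlinear (A n)" "\<And>j. f j - g j \<in> hpow M"
  shows "(A \<star> f) i - (A \<star> g) i \<in> hpow M"
  unfolding ser_app_def
proof (rule hsum_cong_mod)
  show "A (i - j) (f j) - A (i - j) (g j) \<in> hpow M" for j
    using hlinear_hpow[OF assms(1) assms(2)] by (simp add: hlinear_simps[OF assms(1)])
qed

lemma hlinear_ser_comp:
  assumes A: "\<And>n. hlinear (A n)" and B: "\<And>n. hlinear (B n)"
    and "\<And>t. applicable A (\<lambda>j. B j t)"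
  shows "hlinear ((A \<odot> B) i)"
proof -
  have s: "hsummable (\<lambda>j. A (i - j) (B j t))" for t
    using assms(3) by (simp add: applicable_def)
  show ?thesis
  proof (rule hlinearI)
    show "(A \<odot> B) i (v + w) = (A \<odot> B) i v + (A \<odot> B) i w" for v w
      by (simp add: ser_comp_def hlinear_simps(2)[OF A] hlinear_simps(2)[OF B] hsum_add s)
    show "(A \<odot> B) i (c *\<^sub>h v) = c *\<^sub>h (A \<odot> B) i v" for c v
      by (simp add: ser_comp_def hlinear_simps(5)[OF A] hlinear_simps(5)[OF B]
          hlinear_hsum[OF hlinear_hscale[OF hlinear_id] s])
  qed
qed

lemma hsummable_shift: "hsummable F \<Longrightarrow> hsummable (\<lambda>j. F (j - d))" for d :: "'i::ab_group_add"
  by (rule hsummable_compose_inj[OF bij_is_inj[OF bij_shift]])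

text \<open>
  The factor \<open>x + s y\<close> is a sum of two monomials, and multiplication by a monomial shifts the index of
  summation.
\<close>

lemma
  fixes A :: "(int \<times> int, 'k::comm_ring_1, 'a, 'b) opseries"
  assumes A: "\<And>n. hlinear (A n)" and f: "applicable A f"
  shows applicable_mult_lin: "applicable A (mult_lin s f)"
    and ser_app_mult_lin: "A \<star> mult_lin s f = mult_lin s (A \<star> f)"
proof -
  have eq: "mult_lin s g i = g (i - (1, 0)) + fps_const s *\<^sub>h g (i - (0, 1))"
    for g :: "int \<times> int \<Rightarrow> ('k, 'd) tfree" and i
    by (cases i) (simp add: mult_lin_def)
  have s: "hsummable (\<lambda>j. A (i - j) (f (j - d)))" for i d
    using hsummable_shift[of "\<lambda>j. A (i - d - j) (f j)" d] f[unfolded applicable_def, rule_format, of "i - d"]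
    by simp
  have s': "hsummable (\<lambda>j. fps_const s *\<^sub>h A (i - j) (f (j - d)))" for i d
    by (rule hsummable_linear[OF hlinear_hscale[OF hlinear_id] s])
  have e: "A n (mult_lin s f j) = A n (f (j - (1, 0))) + fps_const s *\<^sub>h A n (f (j - (0, 1)))" for n j
    by (simp add: eq hlinear_simps[OF A])
  show "applicable A (mult_lin s f)"
    unfolding applicable_def e by (intro allI hsummable_add s s')
  have shift: "hsum (\<lambda>j. A (i - j) (f (j - d))) = (A \<star> f) (i - d)" for i d
    using hsum_reindex[OF bij_shift[of d], of "\<lambda>j. A (i - d - j) (f j)"]
    by (simp add: ser_app_def)
  show "A \<star> mult_lin s f = mult_lin s (A \<star> f)"
  proof
    fix i
    have "(A \<star> mult_lin s f) i =
        hsum (\<lambda>j. A (i - j) (f (j - (1, 0)))) + fps_const s *\<^sub>h hsum (\<lambda>j. A (i - j) (f (j - (0, 1))))"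
      by (simp add: ser_app_def e hsum_add s s' hlinear_hsum[OF hlinear_hscale[OF hlinear_id] s])
    then show "(A \<star> mult_lin s f) i = mult_lin s (A \<star> f) i"
      by (simp add: eq shift)
  qed
qed

lemma ser_app_mult_lin_funpow:
  assumes A: "\<And>n. hlinear (A n)" and f: "applicable A f"
  shows "A \<star> (mult_lin s ^^ N) f = (mult_lin s ^^ N) (A \<star> f)"
proof -
  have "applicable A ((mult_lin s ^^ N) f) \<and> A \<star> (mult_lin s ^^ N) f = (mult_lin s ^^ N) (A \<star> f)"
    by (induction N) (simp_all add: f applicable_mult_lin[OF A] ser_app_mult_lin[OF A])
  then show ?thesis ..
qed

lemma ser_app_in_snd: "(in_snd A \<star> f) (p, q) = (A \<star> (\<lambda>q. f (p, q))) q"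
proof -
  have "hsum (\<lambda>j. in_snd A ((p, q) - j) (f j)) = hsum (\<lambda>q'. in_snd A ((p, q) - (p, q')) (f (p, q')))"
    by (rule hsum_inj) (auto simp: inj_def in_snd_def image_iff split: prod.splits)
  then show ?thesis by (simp add: ser_app_def in_snd_def)
qed

lemma ser_app_in_fst: "(in_fst A \<star> f) (p, q) = (A \<star> (\<lambda>p. f (p, q))) p"
proof -
  have "hsum (\<lambda>j. in_fst A ((p, q) - j) (f j)) = hsum (\<lambda>p'. in_fst A ((p, q) - (p', q)) (f (p', q)))"
    by (rule hsum_inj) (auto simp: inj_def in_fst_def image_iff split: prod.splits)
  then show ?thesis by (simp add: ser_app_def in_fst_def)
qed

lemma applicable_in_snd:
  assumes "\<And>p. applicable A (\<lambda>q. f (p, q))"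
  shows "applicable (in_snd A) f"
  unfolding applicable_def
proof
  fix i :: "int \<times> int"
  obtain p q where i: "i = (p, q)" by (cases i)
  have "hsummable (\<lambda>q'. in_snd A ((p, q) - (p, q')) (f (p, q')))"
    using assms[of p] by (simp add: applicable_def in_snd_def)
  then have "hsummable (\<lambda>j. in_snd A ((p, q) - j) (f j))"
    by (rule hsummable_extend_inj[of _ "\<lambda>q. (p, q)"])
      (auto simp: in_snd_def image_iff split: prod.splits)
  then show "hsummable (\<lambda>j. in_snd A (i - j) (f j))" by (simp add: i)
qed

lemma applicable_in_fst:
  assumes "\<And>q. applicable A (\<lambda>p. f (p, q))"
  shows "applicable (in_fst A) f"
  unfolding applicable_def
proof
  fix i :: "int \<times> int"
  obtain p q where i: "i = (p, q)" by (cases i)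
  have "hsummable (\<lambda>p'. in_fst A ((p, q) - (p', q)) (f (p', q)))"
    using assms[of q] by (simp add: applicable_def in_fst_def)
  then have "hsummable (\<lambda>j. in_fst A ((p, q) - j) (f j))"
    by (rule hsummable_extend_inj[of _ "\<lambda>p. (p, q)"])
      (auto simp: in_fst_def image_iff split: prod.splits)
  then show "hsummable (\<lambda>j. in_fst A (i - j) (f j))" by (simp add: i)
qed

text \<open>
  Modulo each power of \<open>h\<close>, the pole order of \<open>A(z) f\<^sub>l\<close> is bounded independently of \<open>l\<close>. This holds if
  \<open>f\<close> involves finitely many basis vectors modulo each power of \<open>h\<close>, and also if \<open>A\<close> has no negative powers.
\<close>

definition uniform_pole :: "(int, 'k::comm_ring_1, 'a, 'b) opseries \<Rightarrow> (int \<Rightarrow> ('k, 'a) tfree) \<Rightarrow> bool"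
  where "uniform_pole A f \<longleftrightarrow> bounded_below (\<lambda>(r, l). r) (\<lambda>(r, l). A r (f l))"

lemma uniform_pole_fin_dim: "laurent_op A \<Longrightarrow> fin_dim f \<Longrightarrow> uniform_pole A f"
  unfolding uniform_pole_def laurent_op_def by (rule bounded_below_uniform) auto

lemma uniform_pole_nonneg: "(\<And>n v. n < 0 \<Longrightarrow> A n v = 0) \<Longrightarrow> uniform_pole A f"
  unfolding uniform_pole_def bounded_below_def using hpow_intros(1) by (auto intro!: exI[of _ 0])

lemma applicableI:
  assumes A: "\<And>n. hlinear (A n)" and "uniform_pole A f" and "bounded_below (\<lambda>n. n) f"
  shows "applicable A f"
  unfolding applicable_def hsummable_def
proof (intro allI)
  fix i M
  obtain N1 where N1: "\<And>r l. r < N1 \<Longrightarrow> A r (f l) \<in> hpow M"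
    using assms(2) unfolding uniform_pole_def bounded_below_def by force
  obtain N2 where N2: "\<And>l. l < N2 \<Longrightarrow> f l \<in> hpow M"
    using assms(3) unfolding bounded_below_def by force
  have "{j. A (i - j) (f j) \<notin> hpow M} \<subseteq> {N2..i - N1}"
  proof
    fix j assume "j \<in> {j. A (i - j) (f j) \<notin> hpow M}"
    then show "j \<in> {N2..i - N1}"
      using N1[of "i - j" j] hlinear_hpow[OF A N2, of j "i - j"] by force
  qed
  then show "finite {j. A (i - j) (f j) \<notin> hpow M}" by (rule finite_subset) simp
qed

text \<open>
  All three exponents in \<open>A\<^sub>r (B\<^sub>l f\<^sub>j)\<close> are bounded below modulo \<open>h\<^sup>M\<close>, so that for a given value of
  \<open>r + l + j\<close> only finitely many terms remain.
\<close>

lemma ser_app_assoc_laurent: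
  assumes A: "\<And>n. hlinear (A n)" and B: "laurent_op B"
    and f: "bounded_below (\<lambda>n. n) f" "fin_dim f"
    and comp: "\<And>t. uniform_pole A (\<lambda>l. B l t)"
  shows "A \<star> (B \<star> f) = (A \<odot> B) \<star> f"
proof (rule ser_app_assoc[OF A])
  have B': "hlinear (B n)" for n using B by (simp add: laurent_op_def)
  show "applicable B f" by (intro applicableI B' uniform_pole_fin_dim B f)
  fix i
  show "hsummable (\<lambda>(j, l). A (i - j - l) (B l (f j)))"
    unfolding hsummable_def
  proof
    fix M
    have "bounded_below (\<lambda>((r, l), j). r) (\<lambda>((r, l), j). A r (B l (f j)))"
      using bounded_below_uniform[of "\<lambda>(r, l) t. A r (B l t)" "\<lambda>(r, l). r", OF _ _ f(2)]
        hlinear_compose[OF A B'] comp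
      by (simp add: uniform_pole_def case_prod_unfold)
    then obtain N1 where N1: "\<And>r l j. r < N1 \<Longrightarrow> A r (B l (f j)) \<in> hpow M"
      unfolding bounded_below_def by force
    obtain N2 where N2: "\<And>l j. l < N2 \<Longrightarrow> B l (f j) \<in> hpow M"
      using uniform_pole_fin_dim[OF B f(2)] unfolding uniform_pole_def bounded_below_def by force
    obtain N3 where N3: "\<And>j. j < N3 \<Longrightarrow> f j \<in> hpow M"
      using f(1) unfolding bounded_below_def by force
    have "{x. (case x of (j, l) \<Rightarrow> A (i - j - l) (B l (f j))) \<notin> hpow M}
        \<subseteq> {N3..i - N1 - N2} \<times> {N2..i - N1 - N3}"
    proof
      fix x assume x: "x \<in> {x. (case x of (j, l) \<Rightarrow> A (i - j - l) (B l (f j))) \<notin> hpow M}"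
      obtain j l where jl: "x = (j, l)" by (cases x)
      have "i - j - l \<ge> N1" "l \<ge> N2" "j \<ge> N3"
        using x jl N1[of "i - j - l" l j] hlinear_hpow[OF A N2, of l "i - j - l" j]
          hlinear_hpow[OF A hlinear_hpow[OF B' N3], of j "i - j - l" l] by force+
      then show "x \<in> {N3..i - N1 - N2} \<times> {N2..i - N1 - N3}" by (simp add: jl)
    qed
    then show "finite {x. (case x of (j, l) \<Rightarrow> A (i - j - l) (B l (f j))) \<notin> hpow M}"
      by (rule finite_subset) simp
  qed
qed


section \<open>Series in two variables\<close>

lemma ser_deriv_funpow:
  fixes A :: "(int, 'k::field_char_0, 'a, 'b) opseries"
  shows "(ser_deriv ^^ n) A p t = fps_const (pochhammer (of_int p + 1) n) *\<^sub>h A (p + int n) t"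
proof (induction n arbitrary: p)
  case 0
  show ?case by (simp add: hscale_simps)
next
  case (Suc n)
  have c: "(of_int (p + 1) :: 'k fps) = fps_const (of_int p + 1)"
    using fps_of_int[of "p + 1", where 'a = 'k] by simp
  have "(ser_deriv ^^ Suc n) A p t =
      of_int (p + 1) *\<^sub>h fps_const (pochhammer (of_int (p + 1) + 1) n) *\<^sub>h A (p + 1 + int n) t"
    by (simp add: ser_deriv_def Suc.IH)
  also have "\<dots> = fps_const (pochhammer (of_int p + 1) (Suc n)) *\<^sub>h A (p + int (Suc n)) t"
    unfolding c by (simp add: hscale_simps pochhammer_rec add.assoc)
  finally show ?case .
qed

lemma taylor_eq:
  "taylor s A (p, q) t = (if q < 0 then 0
    else fps_const (s ^ nat q * (of_int (p + q) gchoose nat q)) *\<^sub>h A (p + q) t)"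
proof (cases "q < 0")
  case False
  have "of_int (p + q) gchoose nat q = pochhammer (of_int p + 1) (nat q) / (fact (nat q) :: 'b)"
    using False by (simp add: gbinomial_pochhammer' of_nat_nat)
  then show ?thesis
    using False by (simp add: taylor_def ser_deriv_funpow hscale_simps mult.commute)
qed (simp add: taylor_def)

text \<open>
  The substitution \<open>y \<mapsto> -y\<close>. Locality concerns \<open>z\<^sub>1 - z\<^sub>2\<close>, quasi-associativity \<open>(z - w) + w\<close>; this
  substitution carries the one into the other.
\<close>

definition reflect_snd :: "(int \<times> int \<Rightarrow> ('k::comm_ring_1, 'b) tfree) \<Rightarrow> int \<times> int \<Rightarrow> ('k, 'b) tfree"
  where "reflect_snd f = (\<lambda>(p, q). if even q then f (p, q) else - f (p, q))"

lemma reflect_snd_mult_lin: "reflect_snd (mult_lin (- s) f) = mult_lin s (reflect_snd f)"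
  by (auto simp: fun_eq_iff reflect_snd_def mult_lin_def hscale_simps
      fps_const_neg[symmetric] simp del: fps_const_neg)

lemma reflect_snd_mult_lin_funpow:
  "reflect_snd ((mult_lin (- s) ^^ N) f) = (mult_lin s ^^ N) (reflect_snd f)"
  by (induction N) (simp_all add: reflect_snd_mult_lin)

lemma reflect_snd_in_fst:
  assumes "\<And>n. hlinear (A n)"
  shows "reflect_snd (in_fst A \<star> f) = in_fst A \<star> reflect_snd f"
proof
  fix i :: "int \<times> int"
  obtain p q where i: "i = (p, q)" by (cases i)
  show "reflect_snd (in_fst A \<star> f) i = (in_fst A \<star> reflect_snd f) i"
    by (simp add: i reflect_snd_def ser_app_in_fst, simp add: ser_app_def hlinear_simps[OF assms] hsum_uminus)
qed

lemma reflect_snd_in_snd: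
  assumes "\<And>n. hlinear (A n)"
  shows "reflect_snd (in_snd A \<star> f) = in_snd (ser_reflect A) \<star> reflect_snd f"
proof
  fix i :: "int \<times> int"
  obtain p q where i: "i = (p, q)" by (cases i)
  have eq: "ser_reflect A (q - q') (reflect_snd f (p, q')) =
      (if even q then A (q - q') (f (p, q')) else - A (q - q') (f (p, q')))" for q'
    by (auto simp: ser_reflect_def reflect_snd_def hlinear_simps[OF assms])
  have "(ser_reflect A \<star> (\<lambda>q. reflect_snd f (p, q))) q =
      (if even q then (A \<star> (\<lambda>q. f (p, q))) q else - (A \<star> (\<lambda>q. f (p, q))) q)"
    by (simp add: ser_app_def eq hsum_uminus)
  then show "reflect_snd (in_snd A \<star> f) i = (in_snd (ser_reflect A) \<star> reflect_snd f) i"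
    by (simp add: i ser_app_in_snd) (simp add: reflect_snd_def ser_app_in_snd)
qed

lemma reflect_snd_taylor: "reflect_snd (\<lambda>i. taylor s A i t) = (\<lambda>i. taylor (- s) A i t)"
proof
  fix i :: "int \<times> int"
  obtain p q where i: "i = (p, q)" by (cases i)
  show "reflect_snd (\<lambda>i. taylor s A i t) i = taylor (- s) A i t"
  proof (cases "q \<ge> 0 \<and> odd q")
    case True
    then have "odd (nat q)" by (auto simp: even_nat_iff)
    then have "(- s) ^ nat q = - (s ^ nat q)" by simp
    with True show ?thesis
      by (simp add: i reflect_snd_def taylor_eq hscale_simps fps_const_neg[symmetric] del: fps_const_neg)
  next
    case False
    then have "q < 0 \<or> even (nat q)" using even_nat_iff[of q] by linarith
    then have "q < 0 \<or> (- s) ^ nat q = s ^ nat q" by auto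
    with False show ?thesis by (auto simp: i reflect_snd_def taylor_eq)
  qed
qed


lemma ser_app_in_snd_assoc:
  assumes "\<And>p. A \<star> (B \<star> (\<lambda>q. f (p, q))) = (A \<odot> B) \<star> (\<lambda>q. f (p, q))"
  shows "in_snd A \<star> (in_snd B \<star> f) = in_snd (A \<odot> B) \<star> f"
proof (intro ext, clarify)
  fix p q
  have "(\<lambda>q. (in_snd B \<star> f) (p, q)) = B \<star> (\<lambda>q. f (p, q))"
    by (simp add: ser_app_in_snd)
  then show "(in_snd A \<star> (in_snd B \<star> f)) (p, q) = (in_snd (A \<odot> B) \<star> f) (p, q)"
    using assms by (simp add: ser_app_in_snd)
qed

lemma in_snd_app_cong:
  assumes "\<And>n v. A n v = A' n (R v)"
  shows "in_snd A \<star> f = in_snd A' \<star> (\<lambda>j. R (f j))"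
  by (intro ext, clarify) (simp add: ser_app_in_snd, simp add: ser_app_def assms)

lemma
  assumes "\<And>n. hlinear (A n)"
  shows hlinear_in_snd: "hlinear (in_snd A i)"
    and hlinear_in_fst: "hlinear (in_fst A i)"
    and hlinear_taylor: "hlinear (taylor s A i)"
proof -
  obtain p q where i: "i = (p, q)" by (cases i)
  have "in_snd A i = (if p = 0 then A q else (\<lambda>_. 0))"
    "in_fst A i = (if q = 0 then A p else (\<lambda>_. 0))"
    by (auto simp: i in_snd_def in_fst_def)
  then show "hlinear (in_snd A i)" "hlinear (in_fst A i)"
    using assms by (simp_all add: hlinear_zero)
  have "taylor s A i = (if q < 0 then (\<lambda>_. 0) else
      (\<lambda>t. fps_const (s ^ nat q * (of_int (p + q) gchoose nat q)) *\<^sub>h A (p + q) t))"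
    by (simp add: i fun_eq_iff taylor_eq)
  then show "hlinear (taylor s A i)"
    using hlinear_hscale[OF assms] by (simp add: hlinear_zero del: of_int_add)
qed

lemma
  assumes "tensor_laurent_op A"
  shows bounded_below_taylor: "bounded_below snd (\<lambda>i. taylor s A i t)"
    and bounded_below_taylor_fst: "bounded_below (\<lambda>n. n) (\<lambda>p. taylor s A (p, q) t)"
    and fin_dim_taylor: "fin_dim (\<lambda>i. taylor s A i t)"
proof -
  show "bounded_below snd (\<lambda>i. taylor s A i t)"
    unfolding bounded_below_def by (intro allI exI[of _ 0]) (auto simp: taylor_eq hpow_intros(1))
  have "bounded_below (\<lambda>n. n) (\<lambda>n. A n t)"
    using assms by (simp add: tensor_laurent_op_def laurent_op_def)
  then show "bounded_below (\<lambda>n. n) (\<lambda>p. taylor s A (p, q) t)"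
    unfolding bounded_below_def
  proof (intro allI)
    fix M
    assume "\<forall>M. \<exists>N. \<forall>n<N. A n t \<in> hpow M"
    then obtain N where "\<And>n. n < N \<Longrightarrow> A n t \<in> hpow M" by blast
    then show "\<exists>N. \<forall>p<N. taylor s A (p, q) t \<in> hpow M"
      by (intro exI[of _ "N - q"]) (auto simp: taylor_eq hpow_intros(1) intro!: hscale_hpow)
  qed
  have "fin_dim (\<lambda>n. A n t)"
    using assms by (simp add: tensor_laurent_op_def)
  then show "fin_dim (\<lambda>i. taylor s A i t)"
    unfolding fin_dim_def
  proof (intro allI)
    fix M
    assume "\<forall>M. \<exists>B. finite B \<and> (\<forall>n. supp_mod M B (A n t))"
    then obtain B where "finite B" "\<And>n. supp_mod M B (A n t)" by blast
    then show "\<exists>B. finite B \<and> (\<forall>i. supp_mod M B (taylor s A i t))"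
      by (intro exI[of _ B]) (auto simp: taylor_eq supp_mod_hpow[OF hpow_intros(1)] intro!: supp_mod_hscale)
  qed
qed

lemma bounded_below_snd_slice:
  assumes "bounded_below snd f"
  shows "bounded_below (\<lambda>n. n) (\<lambda>q. f (p, q))"
  by (rule bounded_below_compose[OF assms]) simp

text \<open>
  Application of \<open>A(y)\<close> destroys finite-dimensionality of the family of all coefficients, since
  infinitely many coefficients of \<open>A\<close> enter. It survives for each fixed power of \<open>y\<close>, because modulo
  \<open>h\<^sup>M\<close> only finitely many coefficients of \<open>A\<close> contribute to that power. This weaker property suffices for
  a subsequent application of \<open>Y(x)\<close> or \<open>Y(x + y)\<close>.
\<close>

lemma
  assumes A: "laurent_op A"
    and f: "fin_dim f" "bounded_below snd f" "\<And>q. bounded_below (\<lambda>n. n) (\<lambda>p. f (p, q))"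
  shows bounded_below_in_snd_app: "bounded_below snd (in_snd A \<star> f)"
    and bounded_below_fst_in_snd_app: "bounded_below (\<lambda>n. n) (\<lambda>p. (in_snd A \<star> f) (p, q))"
    and fin_dim_in_snd_app: "fin_dim (\<lambda>p. (in_snd A \<star> f) (p, q))"
proof -
  have lin: "hlinear (A n)" for n using A by (simp add: laurent_op_def)
  have "\<exists>N2. \<forall>r j. r < N2 \<longrightarrow> A r (f j) \<in> hpow M" for M
  proof -
    have "bounded_below (\<lambda>(r, j). r) (\<lambda>(r, j). A r (f j))"
      using A f(1) unfolding laurent_op_def by (intro bounded_below_uniform) auto
    then show ?thesis unfolding bounded_below_def by fastforce
  qed
  then obtain N2 where N2: "\<And>M r j. r < N2 M \<Longrightarrow> A r (f j) \<in> hpow M" by metis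
  obtain N1 where N1: "\<And>M p q. q < N1 M \<Longrightarrow> f (p, q) \<in> hpow M"
    using f(2) unfolding bounded_below_def by (metis snd_conv)
  have small: "A (q - q') (f (p, q')) \<in> hpow M" if "q' \<notin> {N1 M..q - N2 M}" for M p q q'
    using that N2[of "q - q'" M] hlinear_hpow[OF lin N1[of q' M]] by force
  have eq: "(in_snd A \<star> f) (p, q) = hsum (\<lambda>q'. A (q - q') (f (p, q')))" for p q
    by (subst ser_app_in_snd) (simp add: ser_app_def)
  have "(in_snd A \<star> f) (p, q) \<in> hpow M" if "q < N1 M + N2 M" for M p q
    unfolding eq using that by (intro hsum_hpow small) auto
  then show "bounded_below snd (in_snd A \<star> f)"
    unfolding bounded_below_def by (metis prod.collapse)
  show "bounded_below (\<lambda>n. n) (\<lambda>p. (in_snd A \<star> f) (p, q))"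
    unfolding bounded_below_def
  proof
    fix M
    have "\<forall>q'. \<exists>N. \<forall>p<N. f (p, q') \<in> hpow M"
      using f(3) unfolding bounded_below_def by blast
    from choice[OF this] obtain N where N: "\<And>p q'. p < N q' \<Longrightarrow> f (p, q') \<in> hpow M" by blast
    let ?N = "Min (insert 0 (N ` {N1 M..q - N2 M}))"
    have "A (q - q') (f (p, q')) \<in> hpow M" if "p < ?N" for p q'
    proof (cases "q' \<in> {N1 M..q - N2 M}")
      case True
      with that show ?thesis by (intro hlinear_hpow[OF lin N]) auto
    qed (rule small)
    then show "\<exists>N. \<forall>p<N. (in_snd A \<star> f) (p, q) \<in> hpow M"
      unfolding eq by (intro exI[of _ ?N] allI impI hsum_hpow)
  qed
  show "fin_dim (\<lambda>p. (in_snd A \<star> f) (p, q))"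
    unfolding fin_dim_def
  proof
    fix M
    let ?s = "\<lambda>p. \<Sum>q'\<in>{N1 M..q - N2 M}. A (q - q') (f (p, q'))"
    have "fin_dim ?s"
      by (intro fin_dim_sum fin_dim_linear[OF lin] fin_dim_compose[OF f(1)]) simp
    then obtain B where B: "finite B" "\<And>p. supp_mod M B (?s p)"
      unfolding fin_dim_def by blast
    have "supp_mod M B ((in_snd A \<star> f) (p, q) - ?s p + ?s p)" for p
      unfolding eq by (intro supp_mod_add B(2) supp_mod_hpow hsum_eq_sum_mod small) auto
    then show "\<exists>B. finite B \<and> (\<forall>p. supp_mod M B ((in_snd A \<star> f) (p, q)))"
      using B(1) by auto
  qed
qed

lemma eq_mod_hpow_mult_lin_mono:
  fixes f g :: "int \<times> int \<Rightarrow> ('k::comm_ring_1, 'b) tfree"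
  assumes "eq_mod_hpow M ((mult_lin s ^^ N) f) ((mult_lin s ^^ N) g)" "N \<le> N'"
  shows "eq_mod_hpow M ((mult_lin s ^^ N') f) ((mult_lin s ^^ N') g)"
  using assms(2)
proof (induction N' rule: dec_induct)
  case base
  show ?case by (fact assms(1))
next
  case (step n)
  have "mult_lin s f' (p, q) - mult_lin s g' (p, q) =
      (f' (p - 1, q) - g' (p - 1, q)) + fps_const s *\<^sub>h (f' (p, q - 1) - g' (p, q - 1))"
    for f' g' :: "int \<times> int \<Rightarrow> ('k, 'b) tfree" and p q
    by (simp add: mult_lin_def hlinear_simps(4)[OF hlinear_hscale[OF hlinear_id]])
  with step.IH show ?case
    by (auto simp: eq_mod_hpow_def intro!: hpow_intros(2) hscale_hpow)
qed

text \<open>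
  In a series without negative powers of \<open>y\<close>, only the term \<open>x\<^sup>N\<close> of \<open>(x + s y)\<^sup>N\<close> contributes to \<open>y\<^sup>0\<close>.
\<close>

lemma mult_lin_lowest:
  assumes "\<And>p q. q < 0 \<Longrightarrow> f (p, q) = 0"
  shows "(mult_lin s ^^ N) f (p, 0) = f (p - int N, 0)"
proof -
  have "(q < 0 \<longrightarrow> (mult_lin s ^^ N) f (p, q) = 0) \<and> (mult_lin s ^^ N) f (p, 0) = f (p - int N, 0)"
    for p q
    by (induction N arbitrary: p q) (auto simp: mult_lin_def assms hscale_simps algebra_simps)
  then show ?thesis by blast
qed

lemma ser_comp_in_snd_in_fst:
  assumes "\<And>n. A n 0 = 0"
  shows "(in_snd A \<odot> in_fst B) (p, q) t = A q (B p t)"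
  using hsum_single[of "(p, 0)" "\<lambda>j. in_snd A ((p, q) - j) (in_fst B j t)"] assms
  by (auto simp: ser_comp_def in_snd_def in_fst_def split: prod.splits)

text \<open>
  The power \<open>(y - x)\<^sup>n\<close>, expanded in nonnegative powers of \<open>x\<close>, satisfies
  \<open>(x - y)\<^sup>N (y - x)\<^sup>n = (-1)\<^sup>N (y - x)\<^bsup>n + N\<^esup>\<close>; on coefficients this is Pascal's rule.
  The series is \<open>A(y - x)\<close> with \<open>x\<close> as the first variable.
\<close>

lemma mult_lin_funpow_taylor:
  fixes A :: "(int, 'k::field_char_0, 'a, 'b) opseries"
  shows "(mult_lin (- 1) ^^ N) (\<lambda>(b, j). taylor (- 1) A (j, b) t) =
    (\<lambda>(b, j). if b < 0 then 0
      else fps_const ((- 1) ^ (N + nat b) * (of_int (j + b) gchoose nat b)) *\<^sub>h A (j + b - int N) t)"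
    (is "_ = ?\<phi> N")
proof (induction N)
  case 0
  show ?case by (auto simp: fun_eq_iff taylor_eq)
next
  case (Suc N)
  have "mult_lin (- 1) (?\<phi> N) (b, j) = ?\<phi> (Suc N) (b, j)" for b j
  proof (cases "b \<le> 0")
    case True
    then show ?thesis
      by (cases "b = 0")
        (simp_all add: mult_lin_def hscale_simps fps_const_neg[symmetric] algebra_simps del: fps_const_neg)
  next
    case False
    define m where "m = nat (b - 1)"
    have b: "b = int m + 1" using False by (simp add: m_def)
    have neg: "\<not> b < 0" using False by simp
    have nat: "nat b = Suc m" "nat (b - 1) = m" using b by auto
    have idx: "j + (b - 1) - int N = j + b - int (Suc N)" "j - 1 + b - int N = j + b - int (Suc N)"
      by auto
    have pascal: "(of_int (j + b) gchoose Suc m) =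
        (of_int (j + b - 1) gchoose m) + (of_int (j + b - 1) gchoose Suc m :: 'k)"
      using gbinomial_Suc_Suc[of "of_int (j + b - 1) :: 'k" m] by simp
    have c: "(- 1) ^ (N + m) * (of_int (j + b - 1) gchoose m) +
        (- 1) * ((- 1) ^ (N + Suc m) * (of_int (j + b - 1) gchoose Suc m)) =
        (- 1) ^ (Suc N + Suc m) * (of_int (j + b) gchoose Suc m :: 'k)"
      unfolding pascal by (simp add: algebra_simps)
    have "mult_lin (- 1) (?\<phi> N) (b, j) =
        fps_const ((- 1) ^ (N + m) * (of_int (j + b - 1) gchoose m)) *\<^sub>h A (j + b - int (Suc N)) t +
        fps_const (- 1) *\<^sub>h fps_const ((- 1) ^ (N + Suc m) * (of_int (j + b - 1) gchoose Suc m)) *\<^sub>h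
          A (j + b - int (Suc N)) t"
      using False by (simp only: mult_lin_def prod.case idx nat) (simp add: algebra_simps)
    also have "\<dots> = fps_const ((- 1) ^ (N + m) * (of_int (j + b - 1) gchoose m) +
        (- 1) * ((- 1) ^ (N + Suc m) * (of_int (j + b - 1) gchoose Suc m))) *\<^sub>h A (j + b - int (Suc N)) t"
      by (simp only: hscale_simps(6,9) fps_const_add[symmetric] fps_const_mult[symmetric])
    also have "\<dots> = ?\<phi> (Suc N) (b, j)"
      by (simp only: c prod.case neg if_False nat)
    finally show ?thesis .
  qed
  then show ?case by (simp add: Suc.IH fun_eq_iff del: of_nat_Suc)
qed


lemma hlinear_mult_lin_funpow:
  assumes "\<And>i. hlinear (A i)"
  shows "hlinear (\<lambda>t. (mult_lin s ^^ N) (\<lambda>i. A i t) i)"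
proof (induction N arbitrary: i)
  case 0
  show ?case by (simp add: assms)
next
  case (Suc N)
  obtain p q where i: "i = (p, q)" by (cases i)
  have "(\<lambda>t. (mult_lin s ^^ Suc N) (\<lambda>i. A i t) i) =
      (\<lambda>t. (mult_lin s ^^ N) (\<lambda>i. A i t) (p - 1, q) +
        fps_const s *\<^sub>h (mult_lin s ^^ N) (\<lambda>i. A i t) (p, q - 1))"
    unfolding i funpow.simps(2) o_apply by (subst mult_lin_def) simp
  then show ?case using hlinear_add[OF Suc.IH hlinear_hscale[OF Suc.IH]] by (simp only:)
qed


section \<open>Exponential series and commutation with the translation operator\<close>

definition exp_ser :: "(('k::field_char_0, 'b) tfree \<Rightarrow> ('k, 'b) tfree) \<Rightarrow> (int, 'k, 'b, 'b) opseries"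
  where "exp_ser T n v = (if n < 0 then 0 else fps_const (1 / fact (nat n)) *\<^sub>h (T ^^ nat n) v)"

lemma exp_ser_neg: "n < 0 \<Longrightarrow> exp_ser T n v = 0"
  by (simp add: exp_ser_def)

lemma hlinear_exp_ser:
  assumes "hlinear T"
  shows "hlinear (exp_ser T n)"
proof (cases "n < 0")
  case True
  then show ?thesis using hlinear_zero by (simp add: exp_ser_def[abs_def])
next
  case False
  then show ?thesis
    using hlinear_hscale[OF hlinear_funpow[OF assms]] by (simp add: exp_ser_def[abs_def])
qed

lemma uniform_pole_exp_ser: "uniform_pole (exp_ser T) f"
  by (rule uniform_pole_nonneg) (rule exp_ser_neg)

text \<open>
  The binomial theorem in the form \<open>A\<^sup>n / n! = \<Sum> B\<^sup>i / i! \<cdot> C\<^sup>j / j!\<close> for commuting operators whose sum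
  \<open>B + C\<close> acts on a vector \<open>u\<close> as \<open>A\<close> does. Here \<open>F n i j\<close> stands for \<open>A\<^sup>n B\<^sup>i C\<^sup>j u\<close>, and the recursion is
  all that is required of it. It is applied to the derivative, to \<open>T \<circ> _\<close> and to \<open>_ \<circ> (1 \<otimes> T)\<close>, acting on
  the series \<open>Y\<close>.
\<close>

lemma divided_binomial:
  fixes F :: "nat \<Rightarrow> nat \<Rightarrow> nat \<Rightarrow> ('k::field_char_0, 'b) tfree"
  assumes F: "\<And>n i j. F (Suc n) i j = F n (Suc i) j + F n i (Suc j)"
  shows "fps_const (1 / fact n) *\<^sub>h F n 0 0
    = (\<Sum>i\<le>n. fps_const (1 / (fact i * fact (n - i))) *\<^sub>h F 0 i (n - i))"
proof -
  let ?c = "\<lambda>n i. fps_const (of_nat (n choose i)) :: 'k fps"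
  have "F n i0 j0 = (\<Sum>i\<le>n. ?c n i *\<^sub>h F 0 (i0 + i) (j0 + (n - i)))" for i0 j0
  proof (induction n arbitrary: i0 j0)
    case 0
    show ?case by (simp add: hscale_simps)
  next
    case (Suc n)
    let ?g = "\<lambda>i. F 0 (i0 + i) (j0 + (Suc n - i))"
    have "(\<Sum>i\<le>Suc n. ?c (Suc n) i *\<^sub>h ?g i) =
        ?g 0 + (\<Sum>i\<le>n. ?c n (Suc i) *\<^sub>h ?g (Suc i)) + (\<Sum>i\<le>n. ?c n i *\<^sub>h ?g (Suc i))"
      by (subst sum.atMost_Suc_shift)
        (simp add: hscale_simps sum.distrib fps_const_add[symmetric] del: fps_const_add)
    also have "?g 0 + (\<Sum>i\<le>n. ?c n (Suc i) *\<^sub>h ?g (Suc i)) = (\<Sum>i\<le>Suc n. ?c n i *\<^sub>h ?g i)"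
      by (subst sum.atMost_Suc_shift) (simp add: hscale_simps)
    also have "\<dots> = (\<Sum>i\<le>n. ?c n i *\<^sub>h F 0 (i0 + i) (Suc j0 + (n - i)))"
      by (simp add: hscale_simps Suc_diff_le binomial_eq_0)
    finally show ?case
      by (simp add: F Suc.IH add.commute)
  qed
  from this[of 0 0] have "fps_const (1 / fact n) *\<^sub>h F n 0 0 =
      (\<Sum>i\<le>n. fps_const (1 / fact n) *\<^sub>h ?c n i *\<^sub>h F 0 i (n - i))"
    by (simp add: hlinear_simps(6)[OF hlinear_hscale[OF hlinear_id]])
  also have "\<dots> = (\<Sum>i\<le>n. fps_const (1 / (fact i * fact (n - i))) *\<^sub>h F 0 i (n - i))"
    by (intro sum.cong refl) (simp add: hscale_simps binomial_fact)
  finally show ?thesis .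
qed

context braided_voa
begin

abbreviation "T2 \<equiv> tensor_map id T"

lemma laurent_Y: "laurent_op Y"
  using Y_linear Y_laurent by (simp add: laurent_op_def bounded_below_def laurent_def)

lemma tensor_laurent_S: "tensor_laurent_op S"
proof -
  have S: "\<forall>m. \<exists>N B. finite B \<and> (\<forall>n. Poly_Mapping.keys (fps_nth (S n t) m) \<subseteq> B)
      \<and> (\<forall>n<N. fps_nth (S n t) m = 0)" for t
    using S_laurent[of t] by (simp add: tensor_laurent_def)
  have "bounded_below (\<lambda>n. n) (\<lambda>n. S n t) \<and> fin_dim (\<lambda>n. S n t)" for t
  proof -
    obtain N B where NB: "\<And>m. finite (B m)" "\<And>m n. Poly_Mapping.keys (fps_nth (S n t) m) \<subseteq> B m"
      "\<And>m n. n < N m \<Longrightarrow> fps_nth (S n t) m = 0"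
      using S[of t] by metis
    have "S n t \<in> hpow M" if "n < Min (insert 0 (N ` {..<M}))" for n M
      using that by (auto simp: hpow_iff intro!: NB(3))
    moreover have "supp_mod M (\<Union>m<M. B m) (S n t)" for n M
      using NB(2) by (auto simp: supp_mod_def)
    ultimately show ?thesis
      using NB(1) unfolding bounded_below_def fin_dim_def by (meson finite_UN_I finite_lessThan)
  qed
  then show ?thesis by (simp add: tensor_laurent_op_def laurent_op_def S_linear)
qed

lemma Y_deriv_funpow:
  "(ser_deriv ^^ Suc i) Y p t = T ((ser_deriv ^^ i) Y p t) - (ser_deriv ^^ i) Y p (T2 t)"
proof -
  have "(ser_deriv ^^ Suc i) Y p t = (ser_deriv ^^ i) (ser_deriv Y) p t"
    by (simp add: funpow_swap1)
  then show ?thesis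
    by (simp add: ser_deriv_funpow Y_deriv hlinear_simps(5)[OF T_linear]
        hlinear_simps(4)[OF hlinear_hscale[OF hlinear_id]])
qed

lemma hlinear_Y_deriv: "hlinear ((ser_deriv ^^ i) Y p)"
  using hlinear_hscale[OF Y_linear] by (simp add: ser_deriv_funpow[abs_def])

lemma taylor_nat:
  "taylor s Y (p, int i) t = fps_const (s ^ i / fact i) *\<^sub>h (ser_deriv ^^ i) Y p t"
  by (simp add: taylor_def)

text \<open>
  The identity \<open>Y(x + y) (1 \<otimes> e\<^bsup>yT\<^esup>) = e\<^bsup>yT\<^esup> Y(x)\<close>: on \<open>Y\<close>, composition with \<open>T\<close> on the left is the sum of
  the derivative and of composition with \<open>1 \<otimes> T\<close> on the right, and the latter two commute.
\<close>

lemma taylor_Y_exp: "taylor 1 Y \<odot> in_snd (exp_ser T2) = in_snd (exp_ser T) \<odot> in_fst Y"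
proof (intro ext, clarify)
  fix p q t
  define I where "I = (\<lambda>i. q - int i) ` {i. int i \<le> q}"
  have I: "finite I"
    unfolding I_def by (rule finite_imageI, rule finite_subset[of _ "{..nat q}"]) auto
  have "(taylor 1 Y \<odot> in_snd (exp_ser T2)) (p, q) t =
      hsum (\<lambda>a. taylor 1 Y (p, q - a) (exp_ser T2 a t))"
  proof -
    have "hsum (\<lambda>j. taylor 1 Y ((p, q) - j) (in_snd (exp_ser T2) j t)) =
        hsum (\<lambda>a. taylor 1 Y ((p, q) - (0, a)) (in_snd (exp_ser T2) (0, a) t))"
      by (rule hsum_inj)
        (auto simp: inj_def in_snd_def image_iff taylor_eq hlinear_simps[OF Y_linear] hscale_simps
          split: prod.splits)
    then show ?thesis by (simp add: ser_comp_def in_snd_def)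
  qed
  also have "\<dots> = (\<Sum>a\<in>I. taylor 1 Y (p, q - a) (exp_ser T2 a t))"
  proof (rule hsum_eq_sum[OF I])
    fix a assume "a \<notin> I"
    have "q - a < 0 \<or> a < 0"
    proof (rule ccontr)
      assume "\<not> (q - a < 0 \<or> a < 0)"
      then have "a = q - int (nat (q - a))" "int (nat (q - a)) \<le> q" by auto
      with \<open>a \<notin> I\<close> show False unfolding I_def by blast
    qed
    then show "taylor 1 Y (p, q - a) (exp_ser T2 a t) = 0"
      by (auto simp: taylor_eq exp_ser_neg hlinear_simps(1)[OF Y_linear] hscale_simps)
  qed
  also have "\<dots> = exp_ser T q (Y p t)"
  proof (cases "q < 0")
    case True
    then have "I = {}" by (auto simp: I_def)
    with True show ?thesis by (simp add: exp_ser_neg)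
  next
    case False
    then obtain n where n: "q = int n" by (metis nonneg_int_cases not_less)
    let ?F = "\<lambda>n i j. (T ^^ n) ((ser_deriv ^^ i) Y p ((T2 ^^ j) t))"
    have "?F (Suc n) i j = ?F n (Suc i) j + ?F n i (Suc j)" for n i j
    proof -
      let ?x = "(T2 ^^ j) t"
      have "T ((ser_deriv ^^ i) Y p ?x) = (ser_deriv ^^ Suc i) Y p ?x + (ser_deriv ^^ i) Y p (T2 ?x)"
        unfolding Y_deriv_funpow by simp
      then have "(T ^^ n) (T ((ser_deriv ^^ i) Y p ?x)) =
          (T ^^ n) ((ser_deriv ^^ Suc i) Y p ?x) + (T ^^ n) ((ser_deriv ^^ i) Y p (T2 ?x))"
        by (simp only: hlinear_simps(2)[OF hlinear_funpow[OF T_linear]])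
      then show ?thesis by (simp only: funpow_Suc_right[of n T] o_apply funpow.simps(2)[of j T2])
    qed
    from divided_binomial[of ?F, OF this]
    have "fps_const (1 / fact n) *\<^sub>h (T ^^ n) (Y p t) =
        (\<Sum>i\<le>n. fps_const (1 / (fact i * fact (n - i))) *\<^sub>h (ser_deriv ^^ i) Y p ((T2 ^^ (n - i)) t))"
      by simp
    also have "\<dots> = (\<Sum>i\<le>n. taylor 1 Y (p, int i) (exp_ser T2 (int (n - i)) t))"
      by (intro sum.cong refl)
        (simp add: taylor_nat exp_ser_def hlinear_simps(5)[OF hlinear_Y_deriv] hscale_simps del: of_nat_diff)
    also have "\<dots> = (\<Sum>a\<in>I. taylor 1 Y (p, q - a) (exp_ser T2 a t))"
      by (simp add: I_def n sum.reindex inj_on_def of_nat_diff lessThan_Suc_atMost[symmetric]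
          lessThan_def less_Suc_eq_le)
    finally show ?thesis by (simp add: exp_ser_def n)
  qed
  also have "\<dots> = (in_snd (exp_ser T) \<odot> in_fst Y) (p, q) t"
    by (simp add: ser_comp_in_snd_in_fst hlinear_simps(1)[OF hlinear_exp_ser[OF T_linear]])
  finally show "(taylor 1 Y \<odot> in_snd (exp_ser T2)) (p, q) t = (in_snd (exp_ser T) \<odot> in_fst Y) (p, q) t" .
qed

text \<open>
  The identity \<open>Y(y) (1 \<otimes> e\<^bsup>xT\<^esup>) = e\<^bsup>xT\<^esup> Y(y - x)\<close>, expanded in nonnegative powers of \<open>x\<close>. This time
  composition with \<open>1 \<otimes> T\<close> on the right is written as composition with \<open>T\<close> on the left minus the
  derivative.
\<close>

lemma Y_exp: "Y q (exp_ser T2 p t) = (exp_ser T \<star> (\<lambda>b. taylor (- 1) Y (q, b) t)) p"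
proof -
  have eq: "exp_ser T (p - b) (taylor (- 1) Y (q, b) t) = 0" if "b \<notin> {0..p}" for b
    using that by (auto simp: taylor_eq exp_ser_neg hlinear_simps(1)[OF hlinear_exp_ser[OF T_linear]])
  have "(exp_ser T \<star> (\<lambda>b. taylor (- 1) Y (q, b) t)) p =
      (\<Sum>b\<in>{0..p}. exp_ser T (p - b) (taylor (- 1) Y (q, b) t))"
    unfolding ser_app_def by (rule hsum_eq_sum) (use eq in auto)
  also have "\<dots> = Y q (exp_ser T2 p t)"
  proof (cases "p < 0")
    case True
    then show ?thesis by (simp add: exp_ser_neg hlinear_simps(1)[OF Y_linear])
  next
    case False
    then obtain n where n: "p = int n" by (metis nonneg_int_cases not_less)
    let ?F = "\<lambda>n i j. (T ^^ i) (fps_const ((- 1) ^ j) *\<^sub>h (ser_deriv ^^ j) Y q ((T2 ^^ n) t))"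
    have "?F (Suc n) i j = ?F n (Suc i) j + ?F n i (Suc j)" for n i j
    proof -
      let ?x = "(T2 ^^ n) t" and ?c = "fps_const ((- 1) ^ j) :: 'k fps"
      have "(ser_deriv ^^ j) Y q (T2 ?x) = T ((ser_deriv ^^ j) Y q ?x) - (ser_deriv ^^ Suc j) Y q ?x"
        unfolding Y_deriv_funpow by simp
      then have "?c *\<^sub>h (ser_deriv ^^ j) Y q (T2 ?x) =
          T (?c *\<^sub>h (ser_deriv ^^ j) Y q ?x) + fps_const ((- 1) ^ Suc j) *\<^sub>h (ser_deriv ^^ Suc j) Y q ?x"
        by (simp only: hlinear_simps(4)[OF hlinear_hscale[OF hlinear_id]] hlinear_simps(5)[OF T_linear])
          (simp add: hscale_simps fps_const_neg[symmetric] del: fps_const_neg funpow.simps(2))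
      then show ?thesis
        by (simp add: hlinear_simps(2)[OF hlinear_funpow[OF T_linear]] funpow_swap1)
    qed
    from divided_binomial[of ?F, OF this]
    have "fps_const (1 / fact n) *\<^sub>h Y q ((T2 ^^ n) t) =
        (\<Sum>i\<le>n. fps_const (1 / (fact i * fact (n - i))) *\<^sub>h
          (T ^^ i) (fps_const ((- 1) ^ (n - i)) *\<^sub>h (ser_deriv ^^ (n - i)) Y q t))"
      by (simp add: hscale_simps)
    also have "\<dots> = (\<Sum>i\<le>n. exp_ser T (int i) (taylor (- 1) Y (q, int (n - i)) t))"
      by (intro sum.cong refl)
        (simp only: taylor_nat exp_ser_def hlinear_simps(5)[OF hlinear_funpow[OF T_linear]],
          simp add: hscale_simps mult.commute)
    also have "\<dots> = (\<Sum>b\<in>{0..p}. exp_ser T (p - b) (taylor (- 1) Y (q, b) t))"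
      by (rule sum.reindex_bij_witness[of _ "\<lambda>b. nat (p - b)" "\<lambda>i. p - int i"])
        (auto simp: n of_nat_diff)
    finally show ?thesis
      by (simp add: n exp_ser_def hlinear_simps(5)[OF Y_linear])
  qed
  finally show ?thesis ..
qed

text \<open>
  On \<open>v \<otimes> \<Omega>\<close> the derivative axiom becomes the differential equation \<open>f' = T f\<close>, with \<open>f(0) = v\<close>.
\<close>

lemma Y_vacuum: "Y n (v \<otimes>\<^sub>h \<Omega>) = exp_ser T n v"
proof (cases "n < 0")
  case True
  then show ?thesis by (simp add: vacuum_right_regular exp_ser_neg)
next
  case False
  have "Y (int m) (v \<otimes>\<^sub>h \<Omega>) = fps_const (1 / fact m) *\<^sub>h (T ^^ m) v" for m
  proof (induction m)
    case 0
    show ?case by (simp add: vacuum_right hscale_simps)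
  next
    case (Suc m)
    have c: "(of_int (int m + 1) :: 'k fps) = fps_const (of_nat (Suc m))"
      by (simp only: fps_of_nat) simp
    have "T2 (v \<otimes>\<^sub>h \<Omega>) = 0"
      by (simp add: tensor_map_tensor[OF hlinear_id_fun T_linear] T_vacuum
          hlinear_simps(1)[OF hlinear_tensor_right])
    then have "fps_const (of_nat (Suc m)) *\<^sub>h Y (int m + 1) (v \<otimes>\<^sub>h \<Omega>) = fps_const (1 / fact m) *\<^sub>h (T ^^ Suc m) v"
      using Y_deriv[of "int m" "v \<otimes>\<^sub>h \<Omega>"]
      by (simp add: ser_deriv_def Suc.IH c hlinear_simps(1)[OF Y_linear] hlinear_simps(5)[OF T_linear]
          del: of_int_add)
    then have "fps_const (1 / of_nat (Suc m)) *\<^sub>h fps_const (of_nat (Suc m)) *\<^sub>h Y (int m + 1) (v \<otimes>\<^sub>h \<Omega>) =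
        fps_const (1 / of_nat (Suc m)) *\<^sub>h fps_const (1 / fact m) *\<^sub>h (T ^^ Suc m) v"
      by (simp only:)
    then have "Y (int m + 1) (v \<otimes>\<^sub>h \<Omega>) = fps_const (1 / fact (Suc m)) *\<^sub>h (T ^^ Suc m) v"
      by (simp add: hscale_simps del: of_nat_Suc)
    moreover have "int (Suc m) = int m + 1" by simp
    ultimately show ?case by (simp only:)
  qed
  from this[of "nat n"] False show ?thesis by (simp add: exp_ser_def)
qed


section \<open>Skew symmetry\<close>

lemma exp_ser_tensor: "exp_ser T2 n (u \<otimes>\<^sub>h v) = u \<otimes>\<^sub>h exp_ser T n v"
proof -
  have T2: "T2 (u \<otimes>\<^sub>h w) = u \<otimes>\<^sub>h T w" for w
    using tensor_map_tensor[OF hlinear_id_fun T_linear] by simp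
  have "(T2 ^^ m) (u \<otimes>\<^sub>h v) = u \<otimes>\<^sub>h (T ^^ m) v" for m
    by (induction m) (simp_all only: funpow_0 funpow.simps(2) o_apply T2)
  then show ?thesis
    by (simp add: exp_ser_def hlinear_simps(1)[OF hlinear_tensor_right] hlinear_simps(5)[OF hlinear_tensor_right])
qed

lemma one_tensor_tensor: "one_tensor Y n (u \<otimes>\<^sub>h v) = u \<otimes>\<^sub>h Y n v"
  by (simp add: one_tensor_def tensor_map_tensor[OF hlinear_id_fun Y_linear])

lemma hlinear_one_tensor: "hlinear (one_tensor Y n)"
  by (simp add: one_tensor_def hlinear_tensor_map)

lemma hlinear_T2: "hlinear T2"
  by (rule hlinear_tensor_map)

lemma one_tensor_assocr_vacuum: "one_tensor Y n (assocr (s \<otimes>\<^sub>h \<Omega>)) = exp_ser T2 n s"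
proof (rule hlinear_eqI[of "\<lambda>s. one_tensor Y n (assocr (s \<otimes>\<^sub>h \<Omega>))"])
  show "hlinear (\<lambda>s. one_tensor Y n (assocr (s \<otimes>\<^sub>h \<Omega>)))"
    by (intro hlinear_compose[OF hlinear_one_tensor] hlinear_compose[OF hlinear_assocr] hlinear_tensor_left)
  show "hlinear (exp_ser T2 n)" by (rule hlinear_exp_ser[OF hlinear_T2])
  fix a :: "'b \<times> 'b"
  obtain a1 a2 where a: "a = (a1, a2)" by (cases a)
  show "one_tensor Y n (assocr (bvec a \<otimes>\<^sub>h \<Omega>)) = exp_ser T2 n (bvec a)"
    using exp_ser_tensor[of n "bvec a1" "bvec a2"]
    by (simp add: a assocr_tensor_bvec one_tensor_tensor Y_vacuum)
qed

lemma applicable_Y_S: "applicable Y (\<lambda>j. S j t)"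
  using tensor_laurent_S
  by (intro applicableI Y_linear uniform_pole_fin_dim laurent_Y)
    (auto simp: tensor_laurent_op_def laurent_op_def)

text \<open>
  Locality for \<open>v, w, \<Omega>\<close> compares \<open>(x - y)\<^sup>N Y(x) (1 \<otimes> e\<^bsup>yT\<^esup>) S(x - y)(v \<otimes> w)\<close> with
  \<open>(x - y)\<^sup>N Y(y) (1 \<otimes> e\<^bsup>xT\<^esup>)(w \<otimes> v) = e\<^bsup>xT\<^esup> (x - y)\<^sup>N Y(y - x)(w \<otimes> v)\<close>. The first expression has only
  nonnegative powers of \<open>y\<close>. In the second, a power \<open>N\<close> that exceeds the pole order of \<open>Y(z)(w \<otimes> v)\<close>
  modulo \<open>h\<^sup>M\<close> leaves only polynomials in \<open>y - x\<close>. At \<open>y = 0\<close> the two become \<open>x\<^sup>N Y(x) S(x)(v \<otimes> w)\<close>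
  and \<open>x\<^sup>N e\<^bsup>xT\<^esup> Y(-x)(w \<otimes> v)\<close>.
\<close>

lemma skew_symmetry_bvec:
  "(Y \<odot> S) n (bvec (a, b)) = (exp_ser T \<odot> ser_reflect Y) n (bvec (b, a))"
proof (rule eq_if_diff_hpow)
  fix M
  let ?\<tau> = "\<lambda>i. taylor (- 1) (act12 S) i (bvec a \<otimes>\<^sub>h bvec b \<otimes>\<^sub>h \<Omega>)"
  define F where "F = in_fst Y \<star> (in_snd (one_tensor Y) \<star> ?\<tau>)"
  define G where "G = (\<lambda>i. (in_snd Y \<odot> in_fst (one_tensor Y)) i (bvec b \<otimes>\<^sub>h bvec a \<otimes>\<^sub>h \<Omega>))"
  have F_eq: "F = (\<lambda>i. (in_fst Y \<odot> in_snd (one_tensor Y) \<odot> taylor (- 1) (act12 S)) i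
      (bvec a \<otimes>\<^sub>h bvec b \<otimes>\<^sub>h \<Omega>))"
    by (simp only: F_def ser_comp_eq_app)
  obtain N1 where N1: "\<And>n. n < N1 \<Longrightarrow> Y n (bvec (b, a)) \<in> hpow M"
    using Y_laurent[of "bvec (b, a)"] by (auto simp: laurent_def)
  obtain N0 where "eq_mod_hpow M ((mult_lin (- 1) ^^ N0) F) ((mult_lin (- 1) ^^ N0) G)"
    using locality[of M "bvec a" "bvec b"] unfolding F_eq G_def by blast
  then have FG: "eq_mod_hpow M ((mult_lin (- 1) ^^ N) F) ((mult_lin (- 1) ^^ N) G)"
    if "N \<ge> N0" for N
    using eq_mod_hpow_mult_lin_mono that by blast
  \<comment> \<open>The power must also clear the poles of \<open>Y(z)(w \<otimes> v)\<close> modulo \<open>h\<^sup>M\<close>.\<close>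
  define N where "N = max N0 (nat (- N1))"
  \<comment> \<open>The factor \<open>x\<^sup>N\<close> shifts the exponent \<open>n\<close> of \<open>x\<close> by \<open>N\<close>.\<close>
  define P where "P = n + int N"

  have \<tau>: "?\<tau> (p, q) = (if q < 0 then 0 else fps_const ((- 1) ^ nat q * (of_int (p + q) gchoose nat q)) *\<^sub>h
      assocr (S (p + q) (bvec (a, b)) \<otimes>\<^sub>h \<Omega>))" for p q
    by (simp only: taylor_eq act12_def o_apply assocl_tensor_bvec tensor_map_tensor[OF S_linear hlinear_id_fun] id_apply)
  have \<tau>0: "?\<tau> (p, 0) = assocr (S p (bvec (a, b)) \<otimes>\<^sub>h \<Omega>)" for p
    by (simp only: \<tau>) (simp add: hscale_simps)
  have Y\<tau>: "one_tensor Y (q - q') (?\<tau> (p, q')) = 0" if "q' < 0 \<or> q < q'" for p q q'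
    using that unfolding \<tau>
    by (auto simp: hlinear_simps(1)[OF hlinear_one_tensor] hlinear_simps(5)[OF hlinear_one_tensor]
        one_tensor_assocr_vacuum exp_ser_neg hscale_simps)
  have X: "(in_snd (one_tensor Y) \<star> ?\<tau>) (p, q) = 0" if "q < 0" for p q
    unfolding ser_app_in_snd unfolding ser_app_def using that by (subst hsum_eq_sum[of "{}"]) (auto intro!: Y\<tau>)
  have X0: "(in_snd (one_tensor Y) \<star> ?\<tau>) (p, 0) = S p (bvec (a, b))" for p
  proof -
    have "(in_snd (one_tensor Y) \<star> ?\<tau>) (p, 0) = one_tensor Y (0 - 0) (?\<tau> (p, 0))"
      unfolding ser_app_in_snd unfolding ser_app_def by (rule hsum_single) (rule Y\<tau>, auto)
    also have "\<dots> = S p (bvec (a, b))"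
      by (simp only: \<tau>0 one_tensor_assocr_vacuum) (simp add: exp_ser_def hscale_simps)
    finally show ?thesis .
  qed
  have "F (p, q) = 0" if "q < 0" for p q
    unfolding F_def ser_app_in_fst
    by (simp only: ser_app_def[of Y] X[OF that] hlinear_simps(1)[OF Y_linear] hsum_zero)
  then have "(mult_lin (- 1) ^^ N) F (P, 0) = F (n, 0)"
    by (subst mult_lin_lowest) (auto simp: P_def)
  also have "F (n, 0) = (Y \<odot> S) n (bvec (a, b))"
    by (simp only: F_def ser_app_in_fst X0) (simp add: ser_comp_def ser_app_def)
  finally have left: "(mult_lin (- 1) ^^ N) F (P, 0) = (Y \<odot> S) n (bvec (a, b))" .

  let ?\<phi> = "\<lambda>(i, j). taylor (- 1) Y (j, i) (bvec (b, a))"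
  have "G (i, j) = Y j (exp_ser T2 i (bvec (b, a)))" for i j
    using exp_ser_tensor[of i "bvec b" "bvec a"]
    by (simp add: G_def ser_comp_in_snd_in_fst hlinear_simps(1)[OF Y_linear] one_tensor_tensor Y_vacuum)
  then have G: "G = in_fst (exp_ser T) \<star> ?\<phi>"
    by (auto simp: fun_eq_iff ser_app_in_fst Y_exp)
  have E: "hlinear (in_fst (exp_ser T) i)" "hlinear (exp_ser T n)" for i n
    by (intro hlinear_in_fst hlinear_exp_ser T_linear)+
  have "bounded_below (\<lambda>n. n) (\<lambda>p. ?\<phi> (p, q))" for q
    unfolding bounded_below_def by (auto intro!: exI[of _ 0] simp: taylor_eq hpow_intros(1))
  then have "applicable (in_fst (exp_ser T)) ?\<phi>"
    by (intro applicable_in_fst applicableI E uniform_pole_exp_ser)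
  then have "(mult_lin (- 1) ^^ N) G (P, 0) = (in_fst (exp_ser T) \<star> (mult_lin (- 1) ^^ N) ?\<phi>) (P, 0)"
    unfolding G by (simp add: ser_app_mult_lin_funpow[OF E(1)])
  also have "\<dots> = (exp_ser T \<star> (\<lambda>i. (mult_lin (- 1) ^^ N) ?\<phi> (i, 0))) P"
    by (simp only: ser_app_in_fst)
  finally have right: "(mult_lin (- 1) ^^ N) G (P, 0) =
    (exp_ser T \<star> (\<lambda>i. (mult_lin (- 1) ^^ N) ?\<phi> (i, 0))) P" .

  \<comment> \<open>The coefficient of \<open>x\<^sup>i y\<^sup>0\<close> is \<open>(-1)\<^bsup>i - N\<^esup> Y\<^bsub>i - N\<^esub>\<close> for \<open>i \<ge> 0\<close>. For \<open>i < 0\<close> it is zero, and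
    \<open>Y\<^bsub>i - N\<^esub>\<close> vanishes modulo \<open>h\<^sup>M\<close> by the choice of \<open>N\<close>.\<close>
  have "(mult_lin (- 1) ^^ N) ?\<phi> (i, 0) - ser_reflect Y (i - int N) (bvec (b, a)) \<in> hpow M" for i
  proof (cases "i < 0")
    case True
    then have "Y (i - int N) (bvec (b, a)) \<in> hpow M" by (intro N1) (auto simp: N_def)
    with True show ?thesis
      by (auto simp: mult_lin_funpow_taylor ser_reflect_def hpow_intros(4))
  next
    case False
    then obtain m where m: "i = int m" by (metis nonneg_int_cases not_less)
    have "(of_nat m gchoose m) = (1 :: 'k)"
      using binomial_gbinomial[of m m, where 'a = 'k] by simp
    then show ?thesis
      by (cases "even m"; cases "even N")
        (auto simp: m mult_lin_funpow_taylor ser_reflect_def hscale_simps hpow_intros(1)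
          fps_const_neg[symmetric] simp del: fps_const_neg)
  qed
  from ser_app_cong_mod[OF E(2) this]
  have expand: "(exp_ser T \<star> (\<lambda>i. (mult_lin (- 1) ^^ N) ?\<phi> (i, 0))) P -
    (exp_ser T \<star> (\<lambda>i. ser_reflect Y (i - int N) (bvec (b, a)))) P \<in> hpow M" .
  have shift: "(exp_ser T \<star> (\<lambda>i. ser_reflect Y (i - int N) (bvec (b, a)))) P =
      (exp_ser T \<odot> ser_reflect Y) n (bvec (b, a))"
  proof -
    have "n - (i - int N) = P - i" for i by (simp add: P_def)
    then show ?thesis
      using hsum_reindex[OF bij_shift[of "int N"], of "\<lambda>j. exp_ser T (n - j) (ser_reflect Y j (bvec (b, a)))"]
      by (simp only: ser_app_def ser_comp_def)
  qed
  have "(mult_lin (- 1) ^^ N) F (P, 0) - (mult_lin (- 1) ^^ N) G (P, 0) \<in> hpow M"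
    using FG[of N] by (simp add: N_def eq_mod_hpow_def)
  from hpow_diff_trans[OF this[unfolded left right] expand[unfolded shift]]
  show "(Y \<odot> S) n (bvec (a, b)) - (exp_ser T \<odot> ser_reflect Y) n (bvec (b, a)) \<in> hpow M" .
qed


lemma applicable_exp_reflect: "applicable (exp_ser T) (\<lambda>j. ser_reflect Y j t)"
  using laurent_op_reflect[OF laurent_Y]
  by (intro applicableI hlinear_exp_ser T_linear uniform_pole_exp_ser) (simp add: laurent_op_def)

lemma hlinear_reflect_Y: "hlinear (ser_reflect Y n)"
  using laurent_op_reflect[OF laurent_Y] by (simp add: laurent_op_def)

lemma skew_symmetry: "(Y \<odot> S) n t = (exp_ser T \<odot> ser_reflect Y) n (flip t)"
proof (rule hlinear_eqI[where g = "\<lambda>t. (exp_ser T \<odot> ser_reflect Y) n (flip t)"])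
  show "hlinear ((Y \<odot> S) n)"
    by (rule hlinear_ser_comp[OF Y_linear S_linear applicable_Y_S])
  show "hlinear (\<lambda>t. (exp_ser T \<odot> ser_reflect Y) n (flip t))"
    by (rule hlinear_compose[OF hlinear_ser_comp[OF hlinear_exp_ser[OF T_linear]
          hlinear_reflect_Y applicable_exp_reflect] hlinear_flip])
  fix a :: "'b \<times> 'b"
  show "(Y \<odot> S) n (bvec a) = (exp_ser T \<odot> ser_reflect Y) n (flip (bvec a))"
    by (cases a) (simp add: skew_symmetry_bvec)
qed

abbreviation "Y1 \<equiv> one_tensor Y"
abbreviation "flip23 \<equiv> tensor_map (id :: ('k, 'b) tfree \<Rightarrow> _) flip"

lemma laurent_Y1: "laurent_op Y1"
  using laurent_op_tensor_map_right[OF laurent_Y] by (simp add: one_tensor_def[abs_def])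

lemma tensor_laurent_act23: "tensor_laurent_op (act23 S)"
  using tensor_laurent_op_tensor_map_right[OF tensor_laurent_S] by (simp add: act23_def[abs_def])

lemma tensor_laurent_act12: "tensor_laurent_op (act12 S)"
  using tensor_laurent_op_compose[OF tensor_laurent_op_tensor_map_left[OF tensor_laurent_S]
      hlinear_assocr hlinear_assocl]
  by (simp add: act12_def[abs_def] comp_def)

lemma tensor_laurent_act13: "tensor_laurent_op (act13 S)"
  using tensor_laurent_op_compose[OF tensor_laurent_act12, of flip23 flip23]
  by (simp add: act13_def[abs_def] comp_def hlinear_tensor_map)

lemma flip23_act13: "flip23 (act13 S n t) = act12 S n (flip23 t)"
proof -
  have "flip23 (flip23 u) = u" for u
  proof (rule hlinear_eqI[of "\<lambda>u. flip23 (flip23 u)"])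
    show "flip23 (flip23 (bvec a)) = bvec a" for a by (cases a) simp
  qed (rule hlinear_compose[OF hlinear_tensor_map hlinear_tensor_map] hlinear_id)+
  then show ?thesis by (simp add: act13_def)
qed

lemma hlinear_reflect_Y1: "hlinear (ser_reflect Y1 n)"
  using laurent_op_reflect[OF laurent_Y1] by (simp add: laurent_op_def)

lemma reflect_Y1_tensor: "ser_reflect Y1 n (u \<otimes>\<^sub>h v) = u \<otimes>\<^sub>h ser_reflect Y n v"
  by (simp add: ser_reflect_def one_tensor_tensor hlinear_simps(3)[OF hlinear_tensor_right])

lemma applicable_exp_reflect_Y1: "applicable (exp_ser T2) (\<lambda>j. ser_reflect Y1 j t)"
  using laurent_op_reflect[OF laurent_Y1]
  by (intro applicableI hlinear_exp_ser hlinear_T2 uniform_pole_exp_ser) (simp add: laurent_op_def)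

text \<open>
  Skew symmetry in the second and third tensor factor. The flip that it produces will be moved past
  \<open>S\<^sup>1\<^sup>3\<close>, which it turns into \<open>S\<^sup>1\<^sup>2\<close>.
\<close>

lemma skew_symmetry_23: "(Y1 \<odot> act23 S) n t = (exp_ser T2 \<odot> ser_reflect Y1) n (flip23 t)"
proof (rule hlinear_eqI[where g = "\<lambda>t. (exp_ser T2 \<odot> ser_reflect Y1) n (flip23 t)"])
  have conv: "applicable Y1 (\<lambda>j. act23 S j t)" for t
    using tensor_laurent_act23
    by (intro applicableI hlinear_one_tensor uniform_pole_fin_dim laurent_Y1)
      (auto simp: tensor_laurent_op_def laurent_op_def)
  have "hlinear (act23 S n)" for n
    by (simp add: act23_def hlinear_tensor_map)
  from hlinear_ser_comp[OF hlinear_one_tensor this conv] show "hlinear ((Y1 \<odot> act23 S) n)" .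
  show "hlinear (\<lambda>t. (exp_ser T2 \<odot> ser_reflect Y1) n (flip23 t))"
    by (rule hlinear_compose[OF hlinear_ser_comp[OF hlinear_exp_ser[OF hlinear_T2]
          hlinear_reflect_Y1 applicable_exp_reflect_Y1] hlinear_tensor_map])
  fix abc :: "'b \<times> 'b \<times> 'b"
  obtain a b c where abc: "abc = (a, b, c)" by (cases abc)
  have "(Y1 \<odot> act23 S) n (bvec abc) = hsum (\<lambda>j. bvec a \<otimes>\<^sub>h Y (n - j) (S j (bvec (b, c))))"
    by (simp add: abc ser_comp_def act23_def one_tensor_tensor)
  also have "\<dots> = bvec a \<otimes>\<^sub>h (Y \<odot> S) n (bvec (b, c))"
    using applicable_Y_S[of "bvec (b, c)"]
    by (simp add: ser_comp_def applicable_def hlinear_hsum[OF hlinear_tensor_right])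
  also have "\<dots> = hsum (\<lambda>j. bvec a \<otimes>\<^sub>h exp_ser T (n - j) (ser_reflect Y j (bvec (c, b))))"
    unfolding skew_symmetry flip_bvec using applicable_exp_reflect[of "bvec (c, b)"]
    by (simp add: ser_comp_def applicable_def hlinear_hsum[OF hlinear_tensor_right])
  also have "\<dots> = (exp_ser T2 \<odot> ser_reflect Y1) n (bvec a \<otimes>\<^sub>h bvec (c, b))"
    by (simp only: ser_comp_def reflect_Y1_tensor exp_ser_tensor)
  finally show "(Y1 \<odot> act23 S) n (bvec abc) = (exp_ser T2 \<odot> ser_reflect Y1) n (flip23 (bvec abc))"
    by (simp add: abc)
qed


section \<open>Locality for arbitrary vectors\<close>

lemma applicable_Y_slices:
  assumes "\<And>q. fin_dim (\<lambda>p. g (p, q))" "\<And>q. bounded_below (\<lambda>n. n) (\<lambda>p. g (p, q))"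
  shows "applicable (in_fst Y) g"
  by (intro applicable_in_fst applicableI Y_linear uniform_pole_fin_dim laurent_Y assms)

lemma taylor_act12_app:
  assumes "laurent_op A"
  shows "bounded_below snd (in_snd A \<star> (\<lambda>i. taylor s (act12 S) i t))"
    and "bounded_below (\<lambda>n. n) (\<lambda>p. (in_snd A \<star> (\<lambda>i. taylor s (act12 S) i t)) (p, q))"
    and "fin_dim (\<lambda>p. (in_snd A \<star> (\<lambda>i. taylor s (act12 S) i t)) (p, q))"
  by (rule bounded_below_in_snd_app[OF assms] bounded_below_fst_in_snd_app[OF assms]
      fin_dim_in_snd_app[OF assms],
      rule fin_dim_taylor[OF tensor_laurent_act12], rule bounded_below_taylor[OF tensor_laurent_act12],
      rule bounded_below_taylor_fst[OF tensor_laurent_act12])+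

lemma hlinear_locality_left: "hlinear ((in_fst Y \<odot> in_snd Y1 \<odot> taylor (- 1) (act12 S)) i)"
proof -
  have S: "hlinear (taylor (- 1) (act12 S) i)" for i
    using tensor_laurent_act12 by (intro hlinear_taylor) (simp add: tensor_laurent_op_def laurent_op_def)
  have Y1: "hlinear (in_snd Y1 i)" for i
    by (intro hlinear_in_snd hlinear_one_tensor)
  have "applicable (in_snd Y1) (\<lambda>j. taylor (- 1) (act12 S) j t)" for t
    by (intro applicable_in_snd applicableI hlinear_one_tensor uniform_pole_fin_dim laurent_Y1
        fin_dim_compose[OF fin_dim_taylor] bounded_below_snd_slice bounded_below_taylor tensor_laurent_act12)
  note X = hlinear_ser_comp[OF Y1 S this]
  have Y: "hlinear (in_fst Y i)" for i
    by (rule hlinear_in_fst[OF Y_linear])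
  have "applicable (in_fst Y) (\<lambda>j. (in_snd Y1 \<odot> taylor (- 1) (act12 S)) j t)" for t
    unfolding ser_comp_eq_app by (intro applicable_Y_slices taylor_act12_app laurent_Y1)
  from hlinear_ser_comp[OF Y X this] show ?thesis .
qed

text \<open>
  The power \<open>N\<close> in the axiom depends on the basis vectors. Modulo \<open>h\<^sup>M\<close> an arbitrary vector is a
  combination of finitely many of them, so that the maximum of their powers works.
\<close>

lemma locality_general:
  "\<exists>N. eq_mod_hpow M
    ((mult_lin (- 1) ^^ N) (\<lambda>i. (in_fst Y \<odot> in_snd Y1 \<odot> taylor (- 1) (act12 S)) i t))
    ((mult_lin (- 1) ^^ N) (\<lambda>i. (in_snd Y \<odot> in_fst Y1) i (swap12 t)))"
proof -
  let ?A = "in_fst Y \<odot> in_snd Y1 \<odot> taylor (- 1) (act12 S)"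
  let ?B = "\<lambda>i t. (in_snd Y \<odot> in_fst Y1) i (swap12 t)"
  have A: "hlinear (?A i)" for i by (rule hlinear_locality_left)
  have B: "hlinear (?B i)" for i
  proof (cases i)
    case (Pair p q)
    then have "?B i = (\<lambda>t. Y q (Y1 p (swap12 t)))"
      by (simp add: fun_eq_iff ser_comp_in_snd_in_fst hlinear_simps(1)[OF Y_linear])
    then show ?thesis
      using hlinear_compose[OF Y_linear hlinear_compose[OF hlinear_one_tensor hlinear_swap12]] by simp
  qed
  have "\<exists>N. eq_mod_hpow M ((mult_lin (- 1) ^^ N) (\<lambda>i. ?A i (bvec a))) ((mult_lin (- 1) ^^ N) (\<lambda>i. ?B i (bvec a)))" for a
  proof -
    obtain a1 a2 a3 where a: "a = (a1, a2, a3)" by (cases a)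
    have "swap12 (bvec a1 \<otimes>\<^sub>h bvec a2 \<otimes>\<^sub>h bvec a3 :: ('k, 'b) tfree3) =
        bvec a2 \<otimes>\<^sub>h bvec a1 \<otimes>\<^sub>h bvec a3" by simp
    with locality[of M "bvec a1" "bvec a2"] show ?thesis
      unfolding a tensor_bvec[symmetric] by (simp only:) blast
  qed
  then obtain N where N: "\<And>a. eq_mod_hpow M ((mult_lin (- 1) ^^ N a) (\<lambda>i. ?A i (bvec a)))
      ((mult_lin (- 1) ^^ N a) (\<lambda>i. ?B i (bvec a)))"
    by metis
  obtain D where D: "finite D" "supp_mod M D t" using ex_supp_mod by blast
  define N0 where "N0 = Max (insert 0 (N ` D))"
  let ?A' = "\<lambda>i t. (mult_lin (- 1) ^^ N0) (\<lambda>i. ?A i t) i"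
  let ?B' = "\<lambda>i t. (mult_lin (- 1) ^^ N0) (\<lambda>i. ?B i t) i"
  have "?A' i t - ?B' i t \<in> hpow M" for i
  proof -
    have "?A' i (bvec a) - ?B' i (bvec a) \<in> hpow M" if "a \<in> D" for a
    proof -
      have "N a \<le> N0" using that D(1) by (simp add: N0_def)
      from eq_mod_hpow_mult_lin_mono[OF N this] show ?thesis unfolding eq_mod_hpow_def by blast
    qed
    then have "(\<Sum>a\<in>D. coord a t *\<^sub>h (?A' i (bvec a) - ?B' i (bvec a))) \<in> hpow M"
      by (intro hpow_intros(5) hscale_hpow)
    moreover have "(\<Sum>a\<in>D. coord a t *\<^sub>h (?A' i (bvec a) - ?B' i (bvec a))) =
        (\<Sum>a\<in>D. coord a t *\<^sub>h ?A' i (bvec a)) - (\<Sum>a\<in>D. coord a t *\<^sub>h ?B' i (bvec a))"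
      by (simp only: hlinear_simps(4)[OF hlinear_hscale[OF hlinear_id]] sum_subtractf)
    ultimately have "(\<Sum>a\<in>D. coord a t *\<^sub>h ?A' i (bvec a)) - (\<Sum>a\<in>D. coord a t *\<^sub>h ?B' i (bvec a)) \<in> hpow M"
      by (simp only:)
    from hpow_diff_trans[OF hlinear_expansion_mod[OF hlinear_mult_lin_funpow[OF A] D] this]
    have "?A' i t - (\<Sum>a\<in>D. coord a t *\<^sub>h ?B' i (bvec a)) \<in> hpow M" .
    from hpow_diff_trans[OF this hpow_diff_sym[OF hlinear_expansion_mod[OF hlinear_mult_lin_funpow[OF B] D]]]
    show ?thesis .
  qed
  then show ?thesis by (auto simp: eq_mod_hpow_def)
qed


section \<open>Quasi-associativity\<close>

text \<open>
  The operator identity for \<open>Y(x + y) (1 \<otimes> e\<^bsup>yT\<^esup>)\<close>, applied to a series. On both sides the powers of \<open>y\<close>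
  are confined to a finite range, by the lower bound on \<open>g\<close> and because \<open>e\<^bsup>yT\<^esup>\<close> and the Taylor expansion
  have no negative powers of \<open>y\<close>; for each of these powers the sum over the powers of \<open>x\<close> converges because
  the corresponding coefficient of \<open>g\<close> is bounded below and finite-dimensional.
\<close>

lemma taylor_Y_exp_app:
  assumes g: "bounded_below snd g" "\<And>q. bounded_below (\<lambda>n. n) (\<lambda>p. g (p, q))"
    "\<And>q. fin_dim (\<lambda>p. g (p, q))"
  shows "taylor 1 Y \<star> (in_snd (exp_ser T2) \<star> g) = in_snd (exp_ser T) \<star> (in_fst Y \<star> g)"
proof -
  have E2: "hlinear (exp_ser T2 n)" and E: "hlinear (exp_ser T n)" for n
    by (intro hlinear_exp_ser hlinear_T2 T_linear)+
  have "\<exists>N. \<forall>p q. q < N \<longrightarrow> g (p, q) \<in> hpow M" for M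
    using g(1) unfolding bounded_below_def by (metis snd_conv)
  then obtain N where N: "\<And>M p q. q < N M \<Longrightarrow> g (p, q) \<in> hpow M" by metis

  have "taylor 1 Y \<star> (in_snd (exp_ser T2) \<star> g) = (taylor 1 Y \<odot> in_snd (exp_ser T2)) \<star> g"
  proof (rule ser_app_assoc)
    show "hlinear (taylor 1 Y n)" for n by (rule hlinear_taylor[OF Y_linear])
    show "applicable (in_snd (exp_ser T2)) g"
      by (intro applicable_in_snd applicableI E2 uniform_pole_exp_ser bounded_below_snd_slice g(1))
    fix i :: "int \<times> int"
    obtain p' q' where i: "i = (p', q')" by (cases i)
    show "hsummable (\<lambda>(j, l). taylor 1 Y (i - j - l) (in_snd (exp_ser T2) l (g j)))"
      unfolding hsummable_def
    proof
      fix M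
      let ?P = "\<lambda>q a. {p. Y (p' + q' - q - a - p) (exp_ser T2 a (g (p, q))) \<notin> hpow M}"
      have fin: "finite (?P q a)" for q a
      proof -
        have "applicable Y (\<lambda>p. exp_ser T2 a (g (p, q)))"
          by (intro applicableI Y_linear uniform_pole_fin_dim laurent_Y fin_dim_linear[OF E2]
              bounded_below_linear[OF E2] g)
        then show ?thesis unfolding applicable_def hsummable_def by blast
      qed
      have "{x. (case x of (j, l) \<Rightarrow> taylor 1 Y (i - j - l) (in_snd (exp_ser T2) l (g j))) \<notin> hpow M}
          \<subseteq> (\<Union>q\<in>{N M..q'}. \<Union>a\<in>{0..q' - N M}. (\<lambda>p. ((p, q), (0, a))) ` ?P q a)"
      proof
        fix x assume x: "x \<in> {x. (case x of (j, l) \<Rightarrow> taylor 1 Y (i - j - l) (in_snd (exp_ser T2) l (g j))) \<notin> hpow M}"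
        obtain p q r a where pq: "x = ((p, q), (r, a))" by (metis prod.exhaust)
        have x': "taylor 1 Y (p' - p - r, q' - q - a) (in_snd (exp_ser T2) (r, a) (g (p, q))) \<notin> hpow M"
          using x by (simp add: pq i)
        have r: "r = 0"
        proof (rule ccontr)
          assume "r \<noteq> 0"
          with x' show False
            by (simp add: in_snd_def hlinear_simps(1)[OF hlinear_taylor[OF Y_linear]] hpow_intros(1))
        qed
        have qa: "q' - q - a \<ge> 0"
        proof (rule ccontr)
          assume "\<not> q' - q - a \<ge> 0"
          with x' show False by (simp add: taylor_eq hpow_intros(1))
        qed
        have Y: "Y (p' + q' - q - a - p) (exp_ser T2 a (g (p, q))) \<notin> hpow M"
        proof
          assume "Y (p' + q' - q - a - p) (exp_ser T2 a (g (p, q))) \<in> hpow M"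
          moreover have "p' - p + (q' - q - a) = p' + q' - q - a - p" by simp
          ultimately have "taylor 1 Y (p' - p, q' - q - a) (exp_ser T2 a (g (p, q))) \<in> hpow M"
            unfolding taylor_eq
            by (cases "q' - q - a < 0") (simp_all only: if_True if_False hscale_hpow hpow_intros(1))
          with x' show False by (simp add: r in_snd_def)
        qed
        have "a \<ge> 0"
        proof (rule ccontr)
          assume "\<not> a \<ge> 0"
          with Y show False by (simp add: exp_ser_neg hlinear_simps(1)[OF Y_linear] hpow_intros(1))
        qed
        moreover have "q \<ge> N M"
        proof (rule ccontr)
          assume "\<not> q \<ge> N M"
          with Y show False using hlinear_hpow[OF Y_linear hlinear_hpow[OF E2 N]] by fastforce
        qed
        ultimately show "x \<in> (\<Union>q\<in>{N M..q'}. \<Union>a\<in>{0..q' - N M}. (\<lambda>p. ((p, q), (0, a))) ` ?P q a)"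
          unfolding pq r using qa Y by (intro UN_I[of q] UN_I[of a] image_eqI[of _ _ p]) auto
      qed
      then show "finite {x. (case x of (j, l) \<Rightarrow> taylor 1 Y (i - j - l) (in_snd (exp_ser T2) l (g j))) \<notin> hpow M}"
        by (rule finite_subset) (intro finite_UN_I finite_imageI fin finite_atLeastAtMost_int)
    qed
  qed
  also have "\<dots> = (in_snd (exp_ser T) \<odot> in_fst Y) \<star> g"
    by (simp only: taylor_Y_exp)
  also have "\<dots> = in_snd (exp_ser T) \<star> (in_fst Y \<star> g)"
  proof (rule ser_app_assoc[symmetric])
    show "hlinear (in_snd (exp_ser T) n)" for n by (rule hlinear_in_snd[OF E])
    show "applicable (in_fst Y) g" by (rule applicable_Y_slices) (rule g)+
    fix i :: "int \<times> int"
    obtain p' q' where i: "i = (p', q')" by (cases i)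
    show "hsummable (\<lambda>(j, l). in_snd (exp_ser T) (i - j - l) (in_fst Y l (g j)))"
      unfolding hsummable_def
    proof
      fix M
      let ?P = "\<lambda>q. {p. Y (p' - p) (g (p, q)) \<notin> hpow M}"
      have fin: "finite (?P q)" for q
      proof -
        have "applicable Y (\<lambda>p. g (p, q))"
          by (intro applicableI Y_linear uniform_pole_fin_dim laurent_Y g)
        then show ?thesis unfolding applicable_def hsummable_def by blast
      qed
      have "{x. (case x of (j, l) \<Rightarrow> in_snd (exp_ser T) (i - j - l) (in_fst Y l (g j))) \<notin> hpow M}
          \<subseteq> (\<Union>q\<in>{N M..q'}. (\<lambda>p. ((p, q), (p' - p, 0))) ` ?P q)"
      proof
        fix x assume x: "x \<in> {x. (case x of (j, l) \<Rightarrow> in_snd (exp_ser T) (i - j - l) (in_fst Y l (g j))) \<notin> hpow M}"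
        obtain p q r a where pq: "x = ((p, q), (r, a))" by (metis prod.exhaust)
        have x': "in_snd (exp_ser T) (p' - p - r, q' - q - a) (in_fst Y (r, a) (g (p, q))) \<notin> hpow M"
          using x by (simp add: pq i)
        have a: "a = 0"
        proof (rule ccontr)
          assume "a \<noteq> 0"
          with x' show False
            by (simp add: in_fst_def hlinear_simps(1)[OF hlinear_in_snd[OF E]] hpow_intros(1))
        qed
        have r: "r = p' - p"
        proof (rule ccontr)
          assume "r \<noteq> p' - p"
          with x' show False by (simp add: in_snd_def hpow_intros(1))
        qed
        have EY: "exp_ser T (q' - q) (Y (p' - p) (g (p, q))) \<notin> hpow M"
          using x' by (simp add: a r in_snd_def in_fst_def)
        have "q \<le> q'"
        proof (rule ccontr)
          assume "\<not> q \<le> q'"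
          with EY show False by (simp add: exp_ser_neg hpow_intros(1))
        qed
        moreover have Y: "Y (p' - p) (g (p, q)) \<notin> hpow M"
          using EY hlinear_hpow[OF E] by blast
        moreover have "q \<ge> N M"
        proof (rule ccontr)
          assume "\<not> q \<ge> N M"
          with Y show False using hlinear_hpow[OF Y_linear N] by fastforce
        qed
        ultimately show "x \<in> (\<Union>q\<in>{N M..q'}. (\<lambda>p. ((p, q), (p' - p, 0))) ` ?P q)"
          by (auto simp: pq r a intro!: bexI[of _ q])
      qed
      then show "finite {x. (case x of (j, l) \<Rightarrow> in_snd (exp_ser T) (i - j - l) (in_fst Y l (g j))) \<notin> hpow M}"
        by (rule finite_subset) (intro finite_UN_I finite_imageI fin finite_atLeastAtMost_int)
    qed
  qed
  finally show ?thesis .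
qed

lemma ser_app_assoc_exp_reflect_Y1:
  assumes "bounded_below (\<lambda>n. n) f" "fin_dim f"
  shows "exp_ser T2 \<star> (ser_reflect Y1 \<star> f) = (exp_ser T2 \<odot> ser_reflect Y1) \<star> f"
  by (intro ser_app_assoc_laurent hlinear_exp_ser hlinear_T2 laurent_op_reflect laurent_Y1 assms uniform_pole_exp_ser)

text \<open>
  The left-hand side is \<open>e\<^bsup>yT\<^esup>\<close> applied to one side of locality at \<open>(x, -y)\<close>. The lower bound on the
  powers of \<open>y\<close> allows \<open>e\<^bsup>yT\<^esup>\<close> to be commuted with multiplication by \<open>x + y\<close> later.
\<close>

lemma quasi_associativity_left:
  defines "G \<equiv> \<lambda>t. in_fst Y \<star> (in_snd (ser_reflect Y1) \<star> (\<lambda>i. taylor 1 (act12 S) i (flip23 t)))"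
  shows "(\<lambda>i. (taylor 1 Y \<odot> in_snd Y1 \<odot> in_snd (act23 S) \<odot> taylor 1 (act13 S)) i t) =
      in_snd (exp_ser T) \<star> G t"
    and "bounded_below (\<lambda>n. n) (\<lambda>q. G t (p, q))"
proof -
  let ?f = "\<lambda>i. taylor 1 (act13 S) i t"
  let ?f' = "\<lambda>i. taylor 1 (act12 S) i (flip23 t)"
  let ?g = "in_snd (ser_reflect Y1) \<star> ?f'"
  have "flip23 (?f i) = ?f' i" for i
    by (cases i)
      (simp add: taylor_eq hlinear_simps(1)[OF hlinear_tensor_map] hlinear_simps(5)[OF hlinear_tensor_map]
        flip23_act13)
  then have flip_f: "(\<lambda>i. flip23 (?f i)) = ?f'" by (rule ext)
  have f: "bounded_below (\<lambda>n. n) (\<lambda>q. ?f (p, q))" "fin_dim (\<lambda>q. ?f (p, q))"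
    and f': "bounded_below (\<lambda>n. n) (\<lambda>q. ?f' (p, q))" "fin_dim (\<lambda>q. ?f' (p, q))" for p
    by (intro bounded_below_snd_slice bounded_below_taylor fin_dim_compose[OF fin_dim_taylor]
        tensor_laurent_act13 tensor_laurent_act12)+
  have g: "bounded_below snd ?g" "bounded_below (\<lambda>n. n) (\<lambda>p. ?g (p, q))" "fin_dim (\<lambda>p. ?g (p, q))" for q
    by (intro taylor_act12_app laurent_op_reflect laurent_Y1)+
  have "in_snd Y1 \<star> (in_snd (act23 S) \<star> ?f) = in_snd (Y1 \<odot> act23 S) \<star> ?f"
  proof (rule ser_app_in_snd_assoc, rule ser_app_assoc_laurent[OF hlinear_one_tensor _ f])
    show "laurent_op (act23 S)" "uniform_pole Y1 (\<lambda>l. act23 S l u)" for u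
      using tensor_laurent_act23 by (auto simp: tensor_laurent_op_def intro!: uniform_pole_fin_dim laurent_Y1)
  qed
  also have "\<dots> = in_snd (exp_ser T2 \<odot> ser_reflect Y1) \<star> ?f'"
    unfolding flip_f[symmetric] by (rule in_snd_app_cong) (rule skew_symmetry_23)
  also have "\<dots> = in_snd (exp_ser T2) \<star> ?g"
    by (rule ser_app_in_snd_assoc[symmetric], rule ser_app_assoc_exp_reflect_Y1) (rule f')+
  finally have "taylor 1 Y \<star> (in_snd Y1 \<star> (in_snd (act23 S) \<star> ?f)) =
      taylor 1 Y \<star> (in_snd (exp_ser T2) \<star> ?g)"
    by (rule arg_cong)
  also have "\<dots> = in_snd (exp_ser T) \<star> (in_fst Y \<star> ?g)"
    by (rule taylor_Y_exp_app) (rule g)+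
  finally show "(\<lambda>i. (taylor 1 Y \<odot> in_snd Y1 \<odot> in_snd (act23 S) \<odot> taylor 1 (act13 S)) i t) =
      in_snd (exp_ser T) \<star> G t"
    by (simp only: ser_comp_eq_app G_def)
  have "bounded_below (\<lambda>n. n) (\<lambda>q. hsum (\<lambda>p'. Y (p - p') (?g (p', q))))"
    unfolding bounded_below_def
  proof
    fix M
    obtain N where N: "\<And>p q. q < N \<Longrightarrow> ?g (p, q) \<in> hpow M"
      using g(1) unfolding bounded_below_def by (metis snd_conv)
    show "\<exists>N. \<forall>q<N. hsum (\<lambda>p'. Y (p - p') (?g (p', q))) \<in> hpow M"
      by (intro exI[of _ N] allI impI hsum_hpow hlinear_hpow[OF Y_linear] N)
  qed
  then show "bounded_below (\<lambda>n. n) (\<lambda>q. G t (p, q))"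
    unfolding G_def ser_app_in_fst by (simp only: ser_app_def[of Y])
qed

text \<open>
  The right-hand side is \<open>e\<^bsup>yT\<^esup>\<close> applied to the other side of locality: skew symmetry flips
  \<open>Y(x)(u \<otimes> v) \<otimes> w\<close> into \<open>w \<otimes> Y(x)(u \<otimes> v)\<close>, and this is \<open>1 \<otimes> Y(x)\<close> applied to the cyclically permuted
  vector \<open>w \<otimes> u \<otimes> v\<close>.
\<close>

lemma quasi_associativity_right:
  defines "H \<equiv> \<lambda>t. in_snd (ser_reflect Y) \<star> (\<lambda>j. in_fst Y1 j (swap12 (flip23 t)))"
  shows "(\<lambda>i. (in_snd Y \<odot> in_snd S \<odot> in_fst (tensor_one Y)) i t) = in_snd (exp_ser T) \<star> H t"
    and "bounded_below (\<lambda>n. n) (\<lambda>q. H t (p, q))"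
proof -
  let ?h = "\<lambda>j. in_fst (tensor_one Y) j t"
  let ?h' = "\<lambda>j. in_fst Y1 j (swap12 (flip23 t))"
  have "flip (tensor_one Y n t) = Y1 n (swap12 (flip23 t))" for n
  proof (rule hlinear_eqI[of "\<lambda>t. flip (tensor_one Y n t)"])
    have "hlinear (tensor_one Y n)"
      using hlinear_compose[OF hlinear_tensor_map hlinear_assocl] by (simp add: tensor_one_def comp_def)
    then show "hlinear (\<lambda>t. flip (tensor_one Y n t))" by (rule hlinear_compose[OF hlinear_flip])
    show "hlinear (\<lambda>t. Y1 n (swap12 (flip23 t)))"
      by (rule hlinear_compose[OF hlinear_one_tensor hlinear_compose[OF hlinear_swap12 hlinear_tensor_map]])
    show "flip (tensor_one Y n (bvec a)) = Y1 n (swap12 (flip23 (bvec a)))" for a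
      by (cases a) (simp add: tensor_one_def one_tensor_def flip_tensor)
  qed
  then have "flip (?h j) = ?h' j" for j
    by (cases j) (simp add: in_fst_def hlinear_simps(1)[OF hlinear_flip])
  then have flip_h: "(\<lambda>j. flip (?h j)) = ?h'" by (rule ext)
  have slice: "bounded_below (\<lambda>n. n) (\<lambda>q. in_fst A (p, q) u)" "fin_dim (\<lambda>q. in_fst A (p, q) u)"
    for A :: "(int, 'k, 'd, 'e) opseries" and p u
  proof -
    show "bounded_below (\<lambda>n. n) (\<lambda>q. in_fst A (p, q) u)"
      unfolding bounded_below_def by (auto intro!: exI[of _ 0] simp: in_fst_def hpow_intros(1))
    show "fin_dim (\<lambda>q. in_fst A (p, q) u)"
      unfolding fin_dim_def
    proof
      fix M
      obtain B where "finite B" "supp_mod M B (A p u)" using ex_supp_mod by blast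
      then show "\<exists>B. finite B \<and> (\<forall>q. supp_mod M B (in_fst A (p, q) u))"
        by (intro exI[of _ B]) (auto simp: in_fst_def supp_mod_hpow[OF hpow_intros(1)])
    qed
  qed
  have "in_snd Y \<star> (in_snd S \<star> ?h) = in_snd (Y \<odot> S) \<star> ?h"
  proof (rule ser_app_in_snd_assoc, rule ser_app_assoc_laurent[OF Y_linear _ slice])
    show "laurent_op S" "uniform_pole Y (\<lambda>l. S l u)" for u
      using tensor_laurent_S by (auto simp: tensor_laurent_op_def intro!: uniform_pole_fin_dim laurent_Y)
  qed
  also have "\<dots> = in_snd (exp_ser T \<odot> ser_reflect Y) \<star> ?h'"
    unfolding flip_h[symmetric] by (rule in_snd_app_cong) (rule skew_symmetry)
  also have "\<dots> = in_snd (exp_ser T) \<star> H t"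
    unfolding H_def
    by (rule ser_app_in_snd_assoc[symmetric], rule ser_app_assoc_laurent)
      (intro hlinear_exp_ser T_linear laurent_op_reflect laurent_Y slice uniform_pole_exp_ser)+
  finally show "(\<lambda>i. (in_snd Y \<odot> in_snd S \<odot> in_fst (tensor_one Y)) i t) = in_snd (exp_ser T) \<star> H t"
    by (simp only: ser_comp_eq_app)
  have "H t (p, q) = ser_reflect Y q (Y1 p (swap12 (flip23 t)))" for q
    using ser_comp_in_snd_in_fst[of "ser_reflect Y" Y1 p q] hlinear_simps(1)[OF hlinear_reflect_Y]
    by (simp add: H_def ser_comp_eq_app[symmetric])
  then show "bounded_below (\<lambda>n. n) (\<lambda>q. H t (p, q))"
    using laurent_op_reflect[OF laurent_Y] by (simp add: laurent_op_def)
qed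

lemma reflected_locality:
  "\<exists>N. eq_mod_hpow M
    ((mult_lin 1 ^^ N) (in_fst Y \<star> (in_snd (ser_reflect Y1) \<star> (\<lambda>i. taylor 1 (act12 S) i t))))
    ((mult_lin 1 ^^ N) (in_snd (ser_reflect Y) \<star> (\<lambda>j. in_fst Y1 j (swap12 t))))"
proof -
  have h: "reflect_snd (\<lambda>j. in_fst Y1 j (swap12 t)) = (\<lambda>j. in_fst Y1 j (swap12 t))"
    by (auto simp: fun_eq_iff reflect_snd_def in_fst_def)
  obtain N where "eq_mod_hpow M
      ((mult_lin (- 1) ^^ N) (in_fst Y \<star> (in_snd Y1 \<star> (\<lambda>i. taylor (- 1) (act12 S) i t))))
      ((mult_lin (- 1) ^^ N) (in_snd Y \<star> (\<lambda>j. in_fst Y1 j (swap12 t))))"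
    using locality_general[of M t] unfolding ser_comp_eq_app by blast
  then have "reflect_snd ((mult_lin (- 1) ^^ N) (in_fst Y \<star> (in_snd Y1 \<star> (\<lambda>i. taylor (- 1) (act12 S) i t)))) i -
      reflect_snd ((mult_lin (- 1) ^^ N) (in_snd Y \<star> (\<lambda>j. in_fst Y1 j (swap12 t)))) i \<in> hpow M" for i
    unfolding eq_mod_hpow_def using hpow_intros(4) by (cases i) (auto simp: reflect_snd_def hpow_diff_sym)
  then show ?thesis
    unfolding reflect_snd_mult_lin_funpow reflect_snd_in_fst[OF Y_linear] reflect_snd_in_snd[OF hlinear_one_tensor]
      reflect_snd_in_snd[OF Y_linear] reflect_snd_taylor h
    by (auto simp: eq_mod_hpow_def)
qed

lemma quasi_associativity:
  "\<exists>N. eq_mod_hpow M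
    ((mult_lin 1 ^^ N)
      (\<lambda>i. (taylor 1 Y \<odot> in_snd (one_tensor Y) \<odot> in_snd (act23 S) \<odot> taylor 1 (act13 S)) i t))
    ((mult_lin 1 ^^ N)
      (\<lambda>i. (in_snd Y \<odot> in_snd S \<odot> in_fst (tensor_one Y)) i t))"
proof -
  let ?G = "in_fst Y \<star> (in_snd (ser_reflect Y1) \<star> (\<lambda>i. taylor 1 (act12 S) i (flip23 t)))"
  let ?H = "in_snd (ser_reflect Y) \<star> (\<lambda>j. in_fst Y1 j (swap12 (flip23 t)))"
  obtain N where N: "eq_mod_hpow M ((mult_lin 1 ^^ N) ?G) ((mult_lin 1 ^^ N) ?H)"
    using reflected_locality by blast
  have E: "hlinear (exp_ser T n)" "hlinear (in_snd (exp_ser T) i)" for n i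
    by (intro hlinear_in_snd hlinear_exp_ser T_linear)+
  have "applicable (in_snd (exp_ser T)) ?G" "applicable (in_snd (exp_ser T)) ?H"
    by (intro applicable_in_snd applicableI E uniform_pole_exp_ser
        quasi_associativity_left(2) quasi_associativity_right(2))+
  note mult = this[THEN ser_app_mult_lin_funpow[OF E(2)], symmetric]
  have "eq_mod_hpow M ((mult_lin 1 ^^ N) (in_snd (exp_ser T) \<star> ?G))
      ((mult_lin 1 ^^ N) (in_snd (exp_ser T) \<star> ?H))"
    unfolding mult eq_mod_hpow_def
    by (intro allI ser_app_cong_mod E) (use N in \<open>unfold eq_mod_hpow_def, blast\<close>)
  then show ?thesis
    unfolding quasi_associativity_left(1) quasi_associativity_right(1) by blast
qed

end


(* The two variables of the series are z - w and w, in this order. *)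

theorem proposition1p1:
  fixes Y :: "(int, 'k::field_char_0, 'b \<times> 'b, 'b) opseries"
    and T :: "('k, 'b) tfree \<Rightarrow> ('k, 'b) tfree"
    and \<Omega> :: "('k, 'b) tfree"
    and S :: "(int, 'k, 'b \<times> 'b, 'b \<times> 'b) opseries"
  assumes "braided_voa Y T \<Omega> S"
  shows "\<forall>(t :: ('k, 'b) tfree3) M. \<exists>N. eq_mod_hpow M
    ((mult_lin 1 ^^ N)
      (\<lambda>i. (taylor 1 Y \<odot> in_snd (one_tensor Y) \<odot> in_snd (act23 S) \<odot> taylor 1 (act13 S)) i t))
    ((mult_lin 1 ^^ N)
      (\<lambda>i. (in_snd Y \<odot> in_snd S \<odot> in_fst (tensor_one Y)) i t))"
  using braided_voa.quasi_associativity[OF assms] by blast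

end
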